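(* Let $X_1,X_2,\dots$ be i.i.d. $\mathcal N(\mu_0,\sigma_0^2)$ with law $p_0$ and $\sigma_0^2>0$, and let the eavesdropper have causal source awareness, i.e. side information $s^E_i=\{x^{i-1},z^{i-1}\}$ at time $i$. Let $R\ge 0$ and let the key rate satisfy $R_s\geq 1$ bit per source symbol. Then the optimal secrecy rate-payoff function is $$\Pi_{p_0}(R,R_s)=1-2^{-2R}.$$
   Context: Setting. Alice observes an i.i.d. source sequence $X^n$, $X_i\sim p_0=\mathcal N(\mu_0,\sigma_0^2)$. Alice and Bob share a secret key $K$ uniform on $\{1,\dots,2^{nR_s}\}$, independent of $X^n$. A (possibly stochastic) encoder $f_n$, i.e. a kernel $p(m|x^n,k)$, produces a message $M\in\{1,\dots,2^{nR}\}$, sent noiselessly and seen by both Bob and Eve. Bob uses (possibly stochastic) decoders $g_i$, i.e. kernels $p(y_i|m,k)$, to produce real-valued $Y_i$, $i=1,\dots,n$ (his side information is the key $k$). Eve uses (possibly stochastic) decoders $t_i$, i.e. kernels $p(z_i|m,s^E_i)$, to produce real-valued $Z_i$, where $s^E_i$ is her side information at time $i$; here $x^{i-1}=(x_1,\dots,x_{i-1})$ and similarly for $z^{i-1}$. Rates are in bits (base-2 logarithms). Payoff: $\pi(x,y,z)=\frac{1}{\sigma_0^2}[(z-x)^2-(y-x)^2]$ and $\pi(x^n,y^n,z^n)=\frac1n\sum_{i=1}^n\pi(x_i,y_i,z_i)$. Achievability: $(R,R_s,\Pi)$ is achievable if $$\lim_{n\to\infty}\ \sup_{f_n,\{g_i\}_{i=1}^n}\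 \inf_{\{t_i\}_{i=1}^n}\ \mathbb E\,\pi(X^n,Y^n,Z^n)\ \ge\ \Pi .$$ $\Pi_{p_0}(R,R_s)$ is the maximum $\Pi$ such that $(R,R_s,\Pi)$ is achievable. For causal source awareness, the following characterization of this quantity from earlier literature is taken as given: $$\Pi_{p_0}(R,R_s)=\max_{p(y,u|x)\in\mathcal P}\ \min_{z(\cdot)}\ \mathbb E\,\pi(X,Y,z(U)),\qquad \mathcal P=\{p(y,u|x):\ R_s\ge I(X;Y|U),\ R\ge I(X;U,Y)\},$$ where $X\sim p_0$, $U$ is an auxiliary random variable, and the minimum is over functions $z$ of $u$. *)

theory Defs
  imports "HOL-Probability.Probability"
begin

text \<open>In \<open>normal_density \<mu> \<sigma>\<close>, \<open>\<sigma>\<close> is the standard deviation.\<close>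

definition gaussian_source :: "real \<Rightarrow> real \<Rightarrow> nat \<Rightarrow> (nat \<Rightarrow> real) measure" where
  "gaussian_source \<mu> \<sigma> n = PiM {..<n} (\<lambda>_. density lborel (normal_density \<mu> \<sigma>))"

text \<open>Sequences are indexed from 0, so the past at time \<open>i\<close> has index set \<open>{..<i}\<close>.\<close>

abbreviation seq_space :: "nat \<Rightarrow> (nat \<Rightarrow> real) measure" where
  "seq_space n \<equiv> PiM {..<n} (\<lambda>_. borel)"

text \<open>The set \<open>{1, \<dots>, 2^(nR)}\<close>; the floor matters only if \<open>2^(nR)\<close> is not an integer.\<close>

definition rate_set :: "real \<Rightarrow> nat \<Rightarrow> nat set" where
  "rate_set R n = {1..nat \<lfloor>2 powr (real n * R)\<rfloor>}"

definition encoders :: "real \<Rightarrow> real \<Rightarrow> nat \<Rightarrow> ((nat \<Rightarrow> real) \<times> nat \<Rightarrow> nat measure) set" where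
  "encoders R Rs n =
     (seq_space n \<Otimes>\<^sub>M count_space (rate_set Rs n)) \<rightarrow>\<^sub>M prob_algebra (count_space (rate_set R n))"

definition decoders :: "real \<Rightarrow> real \<Rightarrow> nat \<Rightarrow> (nat \<Rightarrow> nat \<times> nat \<Rightarrow> real measure) set" where
  "decoders R Rs n =
     {g. \<forall>i<n. g i \<in> (count_space (rate_set R n) \<Otimes>\<^sub>M count_space (rate_set Rs n))
                      \<rightarrow>\<^sub>M prob_algebra borel}"

text \<open>Kernels from the message and the causal side information, i.e. the past source symbols
  and the past reconstructions of the eavesdropper.\<close>

definition causal_eavesdroppers ::
    "real \<Rightarrow> nat \<Rightarrow> (nat \<Rightarrow> nat \<times> (nat \<Rightarrow> real) \<times> (nat \<Rightarrow> real) \<Rightarrow> real measure) set" where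
  "causal_eavesdroppers R n =
     {t. \<forall>i<n. t i \<in> (count_space (rate_set R n) \<Otimes>\<^sub>M (seq_space i \<Otimes>\<^sub>M seq_space i))
                      \<rightarrow>\<^sub>M prob_algebra borel}"

text \<open>Law of the first \<open>i\<close> reconstructions of the eavesdropper, given the message \<open>m\<close> and the
  source sequence \<open>x\<close>.\<close>

primrec eve_law ::
    "(nat \<Rightarrow> nat \<times> (nat \<Rightarrow> real) \<times> (nat \<Rightarrow> real) \<Rightarrow> real measure) \<Rightarrow> nat \<Rightarrow> (nat \<Rightarrow> real)
      \<Rightarrow> nat \<Rightarrow> (nat \<Rightarrow> real) measure" where
  "eve_law t m x 0 = return (seq_space 0) (\<lambda>_. undefined)"
| "eve_law t m x (Suc i) =
     do {
       z \<leftarrow> eve_law t m x i;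
       z' \<leftarrow> t i (m, restrict x {..<i}, z);
       return (seq_space (Suc i)) (z(i := z'))
     }"

text \<open>Joint law of \<open>(X\<^sup>n, Y\<^sup>n, Z\<^sup>n)\<close>. The product measure makes the \<open>Y\<^sub>i\<close> conditionally
  independent given the message and the key.\<close>

definition joint_law where
  "joint_law \<mu> \<sigma> Rs n f g t =
     do {
       x \<leftarrow> gaussian_source \<mu> \<sigma> n;
       k \<leftarrow> uniform_count_measure (rate_set Rs n);
       m \<leftarrow> f (x, k);
       y \<leftarrow> PiM {..<n} (\<lambda>i. g i (m, k));
       z \<leftarrow> eve_law t m x n;
       return (seq_space n \<Otimes>\<^sub>M seq_space n \<Otimes>\<^sub>M seq_space n) (x, y, z)
     }"

definition payoff :: "real \<Rightarrow> real \<Rightarrow> real \<Rightarrow> real \<Rightarrow> real" where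
  "payoff \<sigma> x y z = ((z - x)\<^sup>2 - (y - x)\<^sup>2) / \<sigma>\<^sup>2"

definition block_payoff ::
    "real \<Rightarrow> nat \<Rightarrow> (nat \<Rightarrow> real) \<times> (nat \<Rightarrow> real) \<times> (nat \<Rightarrow> real) \<Rightarrow> real" where
  "block_payoff \<sigma> n = (\<lambda>(x, y, z). (\<Sum>i<n. payoff \<sigma> (x i) (y i) (z i)) / real n)"

text \<open>Extended expectation, as kernels need not have second moments. In \<open>ereal\<close>, \<open>\<infinity> - \<infinity> = \<infinity>\<close>;
  this choice does not affect \<open>game_value\<close> below: if \<open>Y\<^sup>n\<close> has infinite mean squared error,
  the eavesdropper attains \<open>-\<infinity>\<close> with \<open>Z\<^sup>n = 0\<close>, and otherwise the subtrahend is finite.\<close>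

definition ext_expectation :: "'a measure \<Rightarrow> ('a \<Rightarrow> real) \<Rightarrow> ereal" where
  "ext_expectation M h =
     enn2ereal (\<integral>\<^sup>+ w. ennreal (h w) \<partial>M) - enn2ereal (\<integral>\<^sup>+ w. ennreal (- h w) \<partial>M)"

definition game_value :: "real \<Rightarrow> real \<Rightarrow> real \<Rightarrow> real \<Rightarrow> nat \<Rightarrow> ereal" where
  "game_value \<mu> \<sigma> R Rs n =
     (SUP (f, g) \<in> encoders R Rs n \<times> decoders R Rs n.
        INF t \<in> causal_eavesdroppers R n.
          ext_expectation (joint_law \<mu> \<sigma> Rs n f g t) (block_payoff \<sigma> n))"

definition achievable :: "real \<Rightarrow> real \<Rightarrow> real \<Rightarrow> real \<Rightarrow> real \<Rightarrow> bool" where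
  "achievable \<mu> \<sigma> R Rs P \<longleftrightarrow> (\<exists>L. game_value \<mu> \<sigma> R Rs \<longlonglongrightarrow> L \<and> ereal P \<le> L)"

text \<open>If there were no greatest achievable value, then \<open>GREATEST\<close> would be an unspecified real;
  an equation with a concrete value can only be derived by exhibiting the maximum.\<close>

definition secrecy_rate_payoff :: "real \<Rightarrow> real \<Rightarrow> real \<Rightarrow> real \<Rightarrow> real" where
  "secrecy_rate_payoff \<mu> \<sigma> R Rs = (GREATEST P. achievable \<mu> \<sigma> R Rs P)"

end

theory Submission
  imports Defs "HOL-Real_Asymp.Real_Asymp"
begin

text \<open>The theorem is proved for the operational definition, without the single-letter formula.

  Converse: the eavesdropper plays the constant \<open>\<mu>\<close>, which costs \<open>\<sigma>\<^sup>2\<close>, and even with the key the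
  receiver cannot beat the Gaussian rate-distortion function.

  Achievability: the key selects signs \<open>\<kappa>\<^sub>1, \<dots>, \<kappa>\<^sub>n\<close>, the encoder applies a rate-distortion code to
  \<open>\<kappa>\<^sub>i (X\<^sub>i - \<mu>) / \<sigma>\<close>, and the receiver undoes the signs. The masked source is again standard normal,
  so the receiver loses nothing; and since the message and the past are compatible with both
  \<open>X\<^sub>i\<close> and its reflection about \<open>\<mu>\<close>, the eavesdropper cannot do better than the constant \<open>\<mu>\<close>.\<close>

section \<open>Product measures and Gaussian moments\<close>

text \<open>The message and the past source together can reveal much of the key, so secrecy cannot
  rest on the key staying hidden. It rests on an exact symmetry: for each time i some permutation of
  the keys flips the i-th sign alone, and this compensates the reflection of the i-th source symbol.
  It takes n key bits for n symbols, which is where \<open>Rs \<ge> 1\<close> comes from, and it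
  bounds the eavesdropper's error at every block length, without a limit. Keys beyond the last
  multiple of 2^n are given up; their share tends to 0.

  The converse also holds at every positive block length. It compares the source law with a Gaussian
  of variance 2 powr (- 2 * R) * \<sigma>^2 around the reconstruction; the unnormalised likelihood
  ratio has the same source mean for every reconstruction. Only the existence of good codes is
  asymptotic. Its covering exponent ln (1 / \<delta>) / 2 is the mutual information, in nats, of a
  Gaussian test channel with noise variance \<delta>. It must lie below R * ln 2, so \<delta> > 2
  powr (- 2 * R); as \<delta> < 1 as well, R = 0 is treated apart.\<close>

text \<open>Lets centring, scaling and sign changes of single symbols act on the whole source.
  Measures are given at every index, as \<open>product_prob_space\<close> asks for.\<close>

lemma distr_PiM_componentwise:
  assumes I: "finite I" and M: "\<And>i. prob_space (M i)" and N: "\<And>i. prob_space (N i)"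
    and f: "\<And>i. f i \<in> M i \<rightarrow>\<^sub>M N i" and d: "\<And>i. distr (M i) (N i) (f i) = N i"
  shows "distr (PiM I M) (PiM I N) (\<lambda>x. \<lambda>i\<in>I. f i (x i)) = PiM I N"
proof -
  interpret M: product_prob_space M I
    using M by (rule product_prob_spaceI)
  interpret N: product_prob_space N I
    using N by (rule product_prob_spaceI)
  have [measurable]: "(\<lambda>x. \<lambda>i\<in>I. f i (x i)) \<in> PiM I M \<rightarrow>\<^sub>M PiM I N"
    using f by measurable
  show ?thesis
  proof (rule N.PiM_eqI[OF I])
    fix A assume A: "\<And>i. i \<in> I \<Longrightarrow> A i \<in> sets (N i)"
    have pre: "(\<lambda>x. \<lambda>i\<in>I. f i (x i)) -` Pi\<^sub>E I A \<inter> space (PiM I M)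
      = Pi\<^sub>E I (\<lambda>i. f i -` A i \<inter> space (M i))"
      by (auto simp: space_PiM PiE_iff)
    have "emeasure (distr (PiM I M) (PiM I N) (\<lambda>x. \<lambda>i\<in>I. f i (x i))) (Pi\<^sub>E I A)
      = emeasure (PiM I M) (Pi\<^sub>E I (\<lambda>i. f i -` A i \<inter> space (M i)))"
      using A I by (subst emeasure_distr) (auto simp: pre intro!: sets_PiM_I_finite)
    also have "\<dots> = (\<Prod>i\<in>I. emeasure (M i) (f i -` A i \<inter> space (M i)))"
      using A I f by (subst M.emeasure_PiM) (auto intro: measurable_sets)
    also have "\<dots> = (\<Prod>i\<in>I. emeasure (N i) (A i))"
    proof (rule prod.cong[OF refl])
      fix i assume "i \<in> I"
      then show "emeasure (M i) (f i -` A i \<inter> space (M i)) = emeasure (N i) (A i)"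
        using emeasure_distr[OF f[of i], of "A i"] A[of i] d[of i] by simp
    qed
    finally show "emeasure (distr (PiM I M) (PiM I N) (\<lambda>x. \<lambda>i\<in>I. f i (x i))) (Pi\<^sub>E I A)
      = (\<Prod>i\<in>I. emeasure (N i) (A i))" .
  qed simp
qed

text \<open>Turns the one-dimensional posterior density into the likelihood ratio of n independent
  coordinates, which the change of measure in \<open>gauss_ball_ge\<close> needs.\<close>

lemma PiM_density:
  assumes I: "finite I" and M: "\<And>i. sigma_finite_measure (M i)"
    and f[measurable]: "\<And>i. f i \<in> borel_measurable (M i)"
    and D: "\<And>i. sigma_finite_measure (density (M i) (f i))"
  shows "PiM I (\<lambda>i. density (M i) (f i)) = density (PiM I M) (\<lambda>x. \<Prod>i\<in>I. f i (x i))"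
proof -
  interpret M: product_sigma_finite M
    by (rule product_sigma_finite.intro) (rule M)
  interpret D: product_sigma_finite "\<lambda>i. density (M i) (f i)"
    by (rule product_sigma_finite.intro) (rule D)
  have [measurable]: "(\<lambda>x. \<Prod>i\<in>I. f i (x i)) \<in> borel_measurable (PiM I M)"
    by measurable
  show ?thesis
  proof (rule D.PiM_eqI[OF I, symmetric])
    show "sets (density (PiM I M) (\<lambda>x. \<Prod>i\<in>I. f i (x i))) = sets (PiM I (\<lambda>i. density (M i) (f i)))"
      by (simp cong: sets_PiM_cong)
    fix A assume A: "\<And>i. i \<in> I \<Longrightarrow> A i \<in> sets (density (M i) (f i))"
    then have A': "\<And>i. i \<in> I \<Longrightarrow> A i \<in> sets (M i)" by simp
    have "emeasure (density (PiM I M) (\<lambda>x. \<Prod>i\<in>I. f i (x i))) (Pi\<^sub>E I A)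
      = (\<integral>\<^sup>+x. (\<Prod>i\<in>I. f i (x i)) * indicator (Pi\<^sub>E I A) x \<partial>PiM I M)"
      using A' I by (subst emeasure_density) (auto intro!: sets_PiM_I_finite)
    also have "\<dots> = (\<integral>\<^sup>+x. (\<Prod>i\<in>I. f i (x i) * indicator (A i) (x i)) \<partial>PiM I M)"
    proof (rule nn_integral_cong)
      fix x assume "x \<in> space (PiM I M)"
      then have "indicator (Pi\<^sub>E I A) x = (\<Prod>i\<in>I. indicator (A i) (x i) :: ennreal)"
        using I by (auto simp: space_PiM PiE_iff indicator_def split: if_splits)
      then show "(\<Prod>i\<in>I. f i (x i)) * indicator (Pi\<^sub>E I A) x
        = (\<Prod>i\<in>I. f i (x i) * indicator (A i) (x i))"
        by (simp add: prod.distrib)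
    qed
    also have "\<dots> = (\<Prod>i\<in>I. \<integral>\<^sup>+x. f i x * indicator (A i) x \<partial>M i)"
      using I A' by (subst M.product_nn_integral_prod) auto
    also have "\<dots> = (\<Prod>i\<in>I. emeasure (density (M i) (f i)) (A i))"
      using A' by (intro prod.cong refl) (simp add: emeasure_density)
    finally show "emeasure (density (PiM I M) (\<lambda>x. \<Prod>i\<in>I. f i (x i))) (Pi\<^sub>E I A)
      = (\<Prod>i\<in>I. emeasure (density (M i) (f i)) (A i))" .
  qed
qed

lemma has_bochner_integral_square_sum_PiM:
  fixes f :: "'i \<Rightarrow> 'a \<Rightarrow> real"
  assumes I: "finite I" and M: "\<And>i. prob_space (M i)"
    and int: "\<And>i. integrable (M i) (f i)" and sq: "\<And>i. integrable (M i) (\<lambda>x. (f i x)\<^sup>2)"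
    and zero: "\<And>i. integral\<^sup>L (M i) (f i) = 0"
  shows "has_bochner_integral (PiM I M) (\<lambda>x. (\<Sum>i\<in>I. f i (x i))\<^sup>2) (\<Sum>i\<in>I. \<integral>x. (f i x)\<^sup>2 \<partial>M i)"
proof -
  interpret M: product_prob_space M I
    using M by (rule product_prob_spaceI)
  have cross: "has_bochner_integral (PiM I M) (\<lambda>x. f i (x i) * f j (x j))
      (if i = j then \<integral>x. (f i x)\<^sup>2 \<partial>M i else 0)" if "i \<in> I" "j \<in> I" for i j
  proof -
    \<comment> \<open>The factor that coordinate k contributes to the product of \<open>f i\<close>
      and \<open>f j\<close>. It brings this product into the form required for integration over a
      product measure, and for \<open>i = j\<close> it yields the square.\<close>
    define h where "h k x = (if k = i then f i x else 1) * (if k = j then f j x else 1)" for k x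
    have h: "integrable (M k) (h k)" for k
      using int[of i] int[of j] sq[of i] M.M.emeasure_space_1[of k]
      by (cases "k = i"; cases "k = j") (auto simp: h_def[abs_def] power2_eq_square)
    have prod: "(\<Prod>k\<in>I. h k (x k)) = f i (x i) * f j (x j)" for x
      using I that by (simp add: h_def prod.distrib if_distrib[where f="\<lambda>u. u (x _)"] prod.delta)
    have "has_bochner_integral (PiM I M) (\<lambda>x. \<Prod>k\<in>I. h k (x k)) (\<Prod>k\<in>I. integral\<^sup>L (M k) (h k))"
      using M.product_integrable_prod[OF I h] M.product_integral_prod[OF I h]
      by (simp add: has_bochner_integral_iff)
    moreover have "(\<Prod>k\<in>I. integral\<^sup>L (M k) (h k)) = (if i = j then \<integral>x. (f i x)\<^sup>2 \<partial>M i else 0)"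
    proof (cases "i = j")
      case True
      have "integral\<^sup>L (M k) (h k) = (if k = i then \<integral>x. (f i x)\<^sup>2 \<partial>M i else 1)" for k
        using True M.M.prob_space[of k] by (auto simp: h_def[abs_def] power2_eq_square)
      then show ?thesis using I that True by simp
    next
      case False
      have "h i = f i" using False by (auto simp: h_def[abs_def])
      then have "integral\<^sup>L (M i) (h i) = 0" using zero by simp
      then show ?thesis using I that False by (auto intro!: prod_zero)
    qed
    ultimately show ?thesis by (simp add: prod)
  qed
  have "has_bochner_integral (PiM I M) (\<lambda>x. \<Sum>i\<in>I. \<Sum>j\<in>I. f i (x i) * f j (x j))
      (\<Sum>i\<in>I. \<Sum>j\<in>I. if i = j then \<integral>x. (f i x)\<^sup>2 \<partial>M i else 0)"
    by (intro has_bochner_integral_sum cross)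
  then show ?thesis
    using I by (simp add: power2_eq_square sum_product)
qed

text \<open>Chebyshev's inequality: Markov's inequality applied to the square of a sum of centred
  independent variables, whose cross terms integrate to zero.\<close>

lemma prob_sum_PiM_ge:
  fixes f :: "'i \<Rightarrow> 'a \<Rightarrow> real"
  assumes I: "finite I" and M: "\<And>i. prob_space (M i)"
    and int: "\<And>i. integrable (M i) (f i)" and sq: "\<And>i. integrable (M i) (\<lambda>x. (f i x)\<^sup>2)"
    and zero: "\<And>i. integral\<^sup>L (M i) (f i) = 0" and a: "a > 0"
  shows "measure (PiM I M) {x \<in> space (PiM I M). a \<le> \<bar>\<Sum>i\<in>I. f i (x i)\<bar>}
    \<le> (\<Sum>i\<in>I. \<integral>x. (f i x)\<^sup>2 \<partial>M i) / a\<^sup>2"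
proof -
  interpret M: product_prob_space M I
    using M by (rule product_prob_spaceI)
  note hb = has_bochner_integral_square_sum_PiM[OF I M int sq zero]
  have [measurable]: "\<And>i. f i \<in> borel_measurable (M i)"
    using int by auto
  have "measure (PiM I M) {x \<in> space (PiM I M). a \<le> \<bar>\<Sum>i\<in>I. f i (x i)\<bar>}
    = measure (PiM I M) {x \<in> space (PiM I M). a\<^sup>2 \<le> (\<Sum>i\<in>I. f i (x i))\<^sup>2}"
    using a by (simp add: abs_le_square_iff[symmetric])
  also have "\<dots> \<le> integral\<^sup>L (PiM I M) (\<lambda>x. (\<Sum>i\<in>I. f i (x i))\<^sup>2) / a\<^sup>2"
    using a hb by (intro integral_Markov_inequality_measure[where A="{}"])
      (auto simp: has_bochner_integral_iff)
  finally show ?thesis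
    using hb by (simp add: has_bochner_integral_iff)
qed

section \<open>Moments, affine images and exponential tilts of one Gaussian variable\<close>

abbreviation gauss :: "real \<Rightarrow> real \<Rightarrow> real measure" where
  "gauss m s \<equiv> density lborel (normal_density m s)"

lemma has_bochner_integral_gauss:
  assumes "s > 0" and [measurable]: "f \<in> borel_measurable borel"
    and "has_bochner_integral lborel (\<lambda>x. normal_density m s x * f x) (c::real)"
  shows "has_bochner_integral (gauss m s) f c"
  using assms by (auto intro!: has_bochner_integral_density simp: normal_density_nonneg)

lemma gauss_moment_1:
  assumes "s > 0" shows "has_bochner_integral (gauss m s) (\<lambda>x. x - m) 0"
  using normal_moment_odd[OF assms, of m 0] by (intro has_bochner_integral_gauss assms) auto

lemma gauss_moment_2:
  assumes "s > 0" shows "has_bochner_integral (gauss m s) (\<lambda>x. (x - m)\<^sup>2) (s\<^sup>2)"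
  using normal_moment_even[OF assms, of m 1] by (intro has_bochner_integral_gauss assms)
    (auto simp: eval_nat_numeral)

lemma gauss_moment_4:
  assumes "s > 0" shows "has_bochner_integral (gauss m s) (\<lambda>x. (x - m)^4) (3 * s^4)"
proof -
  have "fact (2 * 2) / ((2 / s\<^sup>2) ^ 2 * fact 2) = 3 * s ^ 4"
    using assms by (simp add: fact_numeral field_simps power2_eq_square power4_eq_xxxx)
  then show ?thesis
    using normal_moment_even[OF assms, of m 2] by (intro has_bochner_integral_gauss assms) auto
qed

text \<open>The variance \<open>2 * s^4\<close> is the fourth moment \<open>3 * s^4\<close> minus
  the squared second moment. It feeds the Chebyshev bounds for the energy of the source and of the
  posterior noise.\<close>

lemma gauss_variance_of_square:
  assumes "s > 0"
  shows "has_bochner_integral (gauss m s) (\<lambda>x. (x - m)\<^sup>2 - s\<^sup>2) 0"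
    and "has_bochner_integral (gauss m s) (\<lambda>x. ((x - m)\<^sup>2 - s\<^sup>2)\<^sup>2) (2 * s^4)"
proof -
  interpret prob_space "gauss m s" by (rule prob_space_normal_density[OF assms])
  have const: "has_bochner_integral (gauss m s) (\<lambda>x. c) c" for c :: real
    using prob_space by (simp add: has_bochner_integral_iff)
  show "has_bochner_integral (gauss m s) (\<lambda>x. (x - m)\<^sup>2 - s\<^sup>2) 0"
    using has_bochner_integral_diff[OF gauss_moment_2[OF assms] const[of "s\<^sup>2"]] by simp
  have "has_bochner_integral (gauss m s) (\<lambda>x. (x - m)^4 - 2 * s\<^sup>2 * (x - m)\<^sup>2 + s^4)
      (3 * s^4 - 2 * s\<^sup>2 * s\<^sup>2 + s^4)"
    by (intro has_bochner_integral_add has_bochner_integral_diff gauss_moment_4 assms const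
        has_bochner_integral_mult_right gauss_moment_2)
  then show "has_bochner_integral (gauss m s) (\<lambda>x. ((x - m)\<^sup>2 - s\<^sup>2)\<^sup>2) (2 * s^4)"
    by (rule has_bochner_integral_cong[THEN iffD1, rotated -1])
      (auto simp: power2_eq_square power4_eq_xxxx algebra_simps)
qed

lemma nn_integral_gauss_square:
  assumes "s > 0" shows "(\<integral>\<^sup>+x. ennreal ((x - m)\<^sup>2) \<partial>gauss m s) = ennreal (s\<^sup>2)"
  using gauss_moment_2[OF assms, of m]
  by (subst nn_integral_eq_integral) (auto simp: has_bochner_integral_iff)

lemma distr_gauss_affine:
  assumes "s > 0" "b \<noteq> 0"
  shows "distr (gauss m s) borel (\<lambda>x. a + b * x) = gauss (a + b * m) (\<bar>b\<bar> * s)"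
proof -
  interpret prob_space "gauss m s" by (rule prob_space_normal_density[OF assms(1)])
  have "distributed (gauss m s) lborel (\<lambda>x. x) (normal_density m s)"
    unfolding distributed_def by (auto simp: distr_id2)
  from normal_density_affine[OF this assms, of a] show ?thesis
    unfolding distributed_def by (simp cong: distr_cong)
qed

text \<open>The exponential cancels the Gaussian weight around \<open>m\<close> and installs one of
  variance \<open>s\<^sup>2 * d\<close> around \<open>y\<close>; only the ratio of the normalising
  constants is left. The value does not depend on \<open>y\<close>, and this makes the converse
  uniform over reconstructions.\<close>

lemma nn_integral_gauss_tilted:
  assumes s: "s > 0" and d: "d > 0"
  shows "(\<integral>\<^sup>+x. ennreal (exp ((x - m)\<^sup>2 / (2 * s\<^sup>2) - (x - y)\<^sup>2 / (2 * s\<^sup>2 * d))) \<partial>gauss m s)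
    = ennreal (sqrt d)"
proof -
  have eq: "normal_density m s x * exp ((x - m)\<^sup>2 / (2 * s\<^sup>2) - (x - y)\<^sup>2 / (2 * s\<^sup>2 * d))
      = sqrt d * normal_density y (s * sqrt d) x" for x
  proof -
    have "exp (- (x - m)\<^sup>2 / (2 * s\<^sup>2)) * exp ((x - m)\<^sup>2 / (2 * s\<^sup>2) - (x - y)\<^sup>2 / (2 * s\<^sup>2 * d))
        = exp (- (x - y)\<^sup>2 / (2 * (s * sqrt d)\<^sup>2))"
      using d by (simp add: mult_exp_exp power_mult_distrib algebra_simps)
    moreover have "1 / sqrt (2 * pi * s\<^sup>2) = sqrt d * (1 / sqrt (2 * pi * (s * sqrt d)\<^sup>2))"
      using s d by (simp add: power_mult_distrib real_sqrt_mult)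
    ultimately show ?thesis
      unfolding normal_density_def by (simp only: mult.assoc)
  qed
  have "(\<integral>\<^sup>+x. ennreal (exp ((x - m)\<^sup>2 / (2 * s\<^sup>2) - (x - y)\<^sup>2 / (2 * s\<^sup>2 * d))) \<partial>gauss m s)
      = (\<integral>\<^sup>+x. ennreal (sqrt d) * ennreal (normal_density y (s * sqrt d) x) \<partial>lborel)"
    using d by (subst nn_integral_density)
      (auto simp: ennreal_mult[symmetric] normal_density_nonneg eq)
  also have "\<dots> = ennreal (sqrt d) * emeasure (gauss y (s * sqrt d)) (space lborel)"
    by (subst nn_integral_cmult) (auto simp: emeasure_density)
  also have "\<dots> = ennreal (sqrt d)"
    using prob_space.emeasure_space_1[OF prob_space_normal_density, of "s * sqrt d" y] s d by simp
  finally show ?thesis .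
qed

section \<open>Integration over the joint law\<close>

lemma rate_set_nonempty: "R \<ge> 0 \<Longrightarrow> rate_set R n \<noteq> {}"
proof -
  assume "R \<ge> 0"
  then have "1 \<le> \<lfloor>2 powr (real n * R)\<rfloor>"
    by (simp add: le_floor_iff ge_one_powr_ge_zero)
  then show ?thesis by (simp add: rate_set_def le_nat_iff)
qed

lemma finite_rate_set [simp]: "finite (rate_set R n)"
  by (simp add: rate_set_def)

lemma sets_gaussian_source [measurable_cong, simp]:
  "sets (gaussian_source \<mu> \<sigma> n) = sets (seq_space n)"
  unfolding gaussian_source_def by (intro sets_PiM_cong) auto

lemma space_gaussian_source [simp]: "space (gaussian_source \<mu> \<sigma> n) = space (seq_space n)"
  by (rule sets_eq_imp_space_eq) simp

lemma prob_space_gaussian_source: "\<sigma> > 0 \<Longrightarrow> prob_space (gaussian_source \<mu> \<sigma> n)"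
  unfolding gaussian_source_def by (intro prob_space_PiM prob_space_normal_density)

text \<open>Messages and keys form a finite discrete space, where measurability only asks that each
  value be a probability measure on the right space.\<close>

lemma PiM_kernel_measurable:
  assumes "g \<in> decoders R Rs n"
  shows "(\<lambda>(m, k). PiM {..<n} (\<lambda>i. g i (m, k)))
    \<in> count_space (rate_set R n) \<Otimes>\<^sub>M count_space (rate_set Rs n) \<rightarrow>\<^sub>M prob_algebra (seq_space n)"
proof -
  have eq: "count_space (rate_set R n) \<Otimes>\<^sub>M count_space (rate_set Rs n)
      = count_space (rate_set R n \<times> rate_set Rs n)"
    by (intro pair_measure_countable countable_finite) simp_all
  have g: "g i p \<in> space (prob_algebra borel)" if "i < n" "p \<in> rate_set R n \<times> rate_set Rs n" for i p
    using assms that measurable_space[of "g i" _ "prob_algebra borel" p]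
    by (auto simp: decoders_def space_pair_measure)
  show ?thesis
    unfolding eq
  proof (intro measurable_count_space_eq1[THEN iffD2] Pi_I, clarify)
    fix m k assume p: "m \<in> rate_set R n" "k \<in> rate_set Rs n"
    have "sets (PiM {..<n} (\<lambda>i. g i (m, k))) = sets (seq_space n)"
      using g p by (intro sets_PiM_cong) (auto simp: space_prob_algebra)
    moreover have "prob_space (PiM {..<n} (\<lambda>i. g i (m, k)))"
      using g p by (intro prob_space_PiM) (auto simp: space_prob_algebra)
    ultimately show "PiM {..<n} (\<lambda>i. g i (m, k)) \<in> space (prob_algebra (seq_space n))"
      by (simp add: space_prob_algebra)
  qed
qed

section \<open>The eavesdropper's sequential law: measurability, causality, marginals\<close>

lemma eve_law_measurable:
  assumes t: "t \<in> causal_eavesdroppers R n" and "i \<le> n"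
  shows "(\<lambda>(m, x). eve_law t m x i) \<in> count_space (rate_set R n) \<Otimes>\<^sub>M seq_space n
    \<rightarrow>\<^sub>M prob_algebra (seq_space i)"
  using \<open>i \<le> n\<close>
proof (induction i)
  case 0
  have "return (seq_space 0) (\<lambda>_. undefined) \<in> space (prob_algebra (seq_space 0))"
    by (auto simp: space_prob_algebra space_PiM intro!: prob_space_return)
  then show ?case by simp
next
  case (Suc i)
  define U where "U = count_space (rate_set R n) \<Otimes>\<^sub>M seq_space n"
  have t': "t i \<in> count_space (rate_set R n) \<Otimes>\<^sub>M (seq_space i \<Otimes>\<^sub>M seq_space i) \<rightarrow>\<^sub>M prob_algebra borel"
    using t Suc.prems by (auto simp: causal_eavesdroppers_def)
  have IH: "(\<lambda>p. eve_law t (fst p) (snd p) i) \<in> U \<rightarrow>\<^sub>M prob_algebra (seq_space i)"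
    using Suc by (simp add: U_def split_beta')
  have restr: "(\<lambda>x. restrict x {..<i}) \<in> seq_space n \<rightarrow>\<^sub>M seq_space i"
    using Suc.prems by (intro measurable_restrict_subset) auto
  have [measurable]: "(\<lambda>q. t i (fst (fst q), restrict (snd (fst q)) {..<i}, snd q))
      \<in> U \<Otimes>\<^sub>M seq_space i \<rightarrow>\<^sub>M prob_algebra borel"
    unfolding U_def by (intro measurable_compose[OF _ t'] measurable_Pair measurable_compose[OF _ restr]) measurable
  have upd: "(\<lambda>r. (snd (fst r))(i := snd r)) \<in> (U \<Otimes>\<^sub>M seq_space i) \<Otimes>\<^sub>M borel \<rightarrow>\<^sub>M seq_space (Suc i)"
    unfolding lessThan_Suc by measurable
  have ret: "(\<lambda>r. return (seq_space (Suc i)) ((snd (fst r))(i := snd r)))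
      \<in> (U \<Otimes>\<^sub>M seq_space i) \<Otimes>\<^sub>M borel \<rightarrow>\<^sub>M prob_algebra (seq_space (Suc i))"
    by (rule measurable_compose[OF upd]) measurable
  have "(\<lambda>q. t i (fst (fst q), restrict (snd (fst q)) {..<i}, snd q) \<bind>
        (\<lambda>z'. return (seq_space (Suc i)) ((snd q)(i := z'))))
      \<in> U \<Otimes>\<^sub>M seq_space i \<rightarrow>\<^sub>M prob_algebra (seq_space (Suc i))"
    by (rule measurable_bind_prob_space2[where N=borel]) (use ret in \<open>simp_all add: split_beta'\<close>)
  then have "(\<lambda>p. eve_law t (fst p) (snd p) i \<bind> (\<lambda>z. t i (fst p, restrict (snd p) {..<i}, z) \<bind>
        (\<lambda>z'. return (seq_space (Suc i)) (z(i := z')))))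
      \<in> U \<rightarrow>\<^sub>M prob_algebra (seq_space (Suc i))"
    by (intro measurable_bind_prob_space2[OF IH]) (simp add: split_beta')
  then show ?case by (simp add: U_def split_beta')
qed

text \<open>Causality: the kernel at time \<open>i\<close> reads only the source symbols before
  \<open>i\<close>, so the first \<open>Suc i\<close> reconstructions, including the one for time
  \<open>i\<close>, do not react to a change of \<open>x i\<close>.\<close>

lemma eve_law_cong:
  "restrict x {..<i} = restrict x' {..<i} \<Longrightarrow> eve_law t m x (Suc i) = eve_law t m x' (Suc i)"
proof (induction i)
  case (Suc i)
  have "restrict x {..<i} = restrict x' {..<i}"
    using Suc.prems by (metis Int_absorb1 lessThan_subset_iff le_SucI order_refl restrict_restrict)
  with Suc show ?case by (simp only: eve_law.simps(2)[of _ _ _ "Suc i"])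
qed simp

lemma eve_law_space:
  assumes t: "t \<in> causal_eavesdroppers R n" and "i \<le> n" "m \<in> rate_set R n" "x \<in> space (seq_space n)"
  shows "eve_law t m x i \<in> space (prob_algebra (seq_space i))"
  using measurable_space[OF eve_law_measurable[OF t \<open>i \<le> n\<close>], of "(m, x)"] assms(3,4)
  by (simp add: space_pair_measure)

lemma nn_integral_eve_law_Suc:
  assumes t: "t \<in> causal_eavesdroppers R n" and "j < n" and m: "m \<in> rate_set R n"
    and x: "x \<in> space (seq_space n)" and h: "h \<in> borel_measurable (seq_space (Suc j))"
  shows "integral\<^sup>N (eve_law t m x (Suc j)) h
    = (\<integral>\<^sup>+z. \<integral>\<^sup>+z'. h (z(j := z')) \<partial>t j (m, restrict x {..<j}, z) \<partial>eve_law t m x j)"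
    and "\<And>z. z \<in> space (seq_space j) \<Longrightarrow> t j (m, restrict x {..<j}, z) \<in> space (prob_algebra borel)"
    and "\<And>z. z \<in> space (seq_space j) \<Longrightarrow> (\<lambda>z'. z(j := z')) \<in> borel \<rightarrow>\<^sub>M seq_space (Suc j)"
proof -
  have E: "eve_law t m x j \<in> space (prob_algebra (seq_space j))"
    using assms by (intro eve_law_space) auto
  then have sets_E [measurable_cong, simp]: "sets (eve_law t m x j) = sets (seq_space j)"
    by (simp add: space_prob_algebra)
  have t': "t j \<in> count_space (rate_set R n) \<Otimes>\<^sub>M (seq_space j \<Otimes>\<^sub>M seq_space j) \<rightarrow>\<^sub>M prob_algebra borel"
    using t \<open>j < n\<close> by (auto simp: causal_eavesdroppers_def)
  have xj: "restrict x {..<j} \<in> space (seq_space j)"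
    using x by (auto simp: space_PiM)
  have T: "(\<lambda>z. t j (m, restrict x {..<j}, z)) \<in> seq_space j \<rightarrow>\<^sub>M prob_algebra borel"
    by (rule measurable_compose[OF _ t'], intro measurable_Pair measurable_const)
      (use m xj in auto)
  show P: "t j (m, restrict x {..<j}, z) \<in> space (prob_algebra borel)"
    if "z \<in> space (seq_space j)" for z
    by (rule measurable_space[OF T that])
  have upd: "(\<lambda>r. (fst r)(j := snd r)) \<in> seq_space j \<Otimes>\<^sub>M borel \<rightarrow>\<^sub>M seq_space (Suc j)"
    unfolding lessThan_Suc by measurable
  show up: "(\<lambda>z'. z(j := z')) \<in> borel \<rightarrow>\<^sub>M seq_space (Suc j)" if "z \<in> space (seq_space j)" for z
    using measurable_compose[OF measurable_Pair1'[OF that] upd] by simp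
  have ret: "(\<lambda>r. return (seq_space (Suc j)) ((fst r)(j := snd r)))
      \<in> seq_space j \<Otimes>\<^sub>M borel \<rightarrow>\<^sub>M prob_algebra (seq_space (Suc j))"
    by (rule measurable_compose[OF upd]) measurable
  have K: "(\<lambda>z. t j (m, restrict x {..<j}, z) \<bind> (\<lambda>z'. return (seq_space (Suc j)) (z(j := z'))))
      \<in> seq_space j \<rightarrow>\<^sub>M prob_algebra (seq_space (Suc j))"
    by (rule measurable_bind_prob_space2[OF T]) (use ret in \<open>simp add: split_beta'\<close>)
  have "integral\<^sup>N (eve_law t m x (Suc j)) h
    = (\<integral>\<^sup>+z. integral\<^sup>N (t j (m, restrict x {..<j}, z) \<bind> (\<lambda>z'. return (seq_space (Suc j)) (z(j := z')))) h
        \<partial>eve_law t m x j)"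
    unfolding eve_law.simps
    by (rule nn_integral_bind[OF h])
      (use measurable_prob_algebraD[OF K] in \<open>simp cong: measurable_cong_sets\<close>)
  also have "\<dots> = (\<integral>\<^sup>+z. \<integral>\<^sup>+z'. h (z(j := z')) \<partial>t j (m, restrict x {..<j}, z) \<partial>eve_law t m x j)"
  proof (rule nn_integral_cong)
    fix z assume "z \<in> space (eve_law t m x j)"
    then have z: "z \<in> space (seq_space j)"
      using sets_eq_imp_space_eq[OF sets_E] by simp
    have sP [measurable_cong]: "sets (t j (m, restrict x {..<j}, z)) = sets borel"
      using P[OF z] by (simp add: space_prob_algebra)
    have "(\<lambda>z'. return (seq_space (Suc j)) (z(j := z')))
        \<in> t j (m, restrict x {..<j}, z) \<rightarrow>\<^sub>M subprob_algebra (seq_space (Suc j))"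
      using measurable_compose[OF up[OF z] return_measurable] by simp
    then have "integral\<^sup>N (t j (m, restrict x {..<j}, z) \<bind> (\<lambda>z'. return (seq_space (Suc j)) (z(j := z')))) h
      = (\<integral>\<^sup>+z'. integral\<^sup>N (return (seq_space (Suc j)) (z(j := z'))) h \<partial>t j (m, restrict x {..<j}, z))"
      by (rule nn_integral_bind[OF h])
    also have "\<dots> = (\<integral>\<^sup>+z'. h (z(j := z')) \<partial>t j (m, restrict x {..<j}, z))"
      using measurable_space[OF up[OF z]] h by (intro nn_integral_cong) (simp add: nn_integral_return)
    finally show "integral\<^sup>N (t j (m, restrict x {..<j}, z) \<bind> (\<lambda>z'. return (seq_space (Suc j)) (z(j := z')))) h
      = (\<integral>\<^sup>+z'. h (z(j := z')) \<partial>t j (m, restrict x {..<j}, z))" .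
  qed
  finally show "integral\<^sup>N (eve_law t m x (Suc j)) h
    = (\<integral>\<^sup>+z. \<integral>\<^sup>+z'. h (z(j := z')) \<partial>t j (m, restrict x {..<j}, z) \<partial>eve_law t m x j)" .
qed

text \<open>Later rounds only append coordinates by kernels of mass one, so the marginal of
  coordinate \<open>i\<close> is final after \<open>Suc i\<close> rounds. This reduces the error at
  time \<open>i\<close> to a law that \<open>eve_law_cong\<close> controls.\<close>

lemma nn_integral_eve_law_component:
  assumes t: "t \<in> causal_eavesdroppers R n" and m: "m \<in> rate_set R n"
    and x: "x \<in> space (seq_space n)" and h: "h \<in> borel_measurable borel"
    and "j \<le> n" "i < j"
  shows "(\<integral>\<^sup>+z. h (z i) \<partial>eve_law t m x j) = (\<integral>\<^sup>+z. h (z i) \<partial>eve_law t m x (Suc i))"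
  using \<open>j \<le> n\<close> \<open>i < j\<close>
proof (induction j)
  case (Suc j)
  show ?case
  proof (cases "i = j")
    case False
    then have ij: "i < j" "j < n" using Suc.prems by simp_all
    have hi: "(\<lambda>z. h (z i)) \<in> borel_measurable (seq_space (Suc j))"
      by (rule measurable_compose[OF measurable_component_singleton]) (use ij h in auto)
    have "eve_law t m x j \<in> space (prob_algebra (seq_space j))"
      using t m x ij by (intro eve_law_space) auto
    then have "space (eve_law t m x j) = space (seq_space j)"
      by (intro sets_eq_imp_space_eq) (simp add: space_prob_algebra)
    then have "(\<integral>\<^sup>+z. h (z i) \<partial>eve_law t m x (Suc j)) = (\<integral>\<^sup>+z. h (z i) \<partial>eve_law t m x j)"
      using ij nn_integral_eve_law_Suc(2)[OF t ij(2) m x hi]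
      by (subst nn_integral_eve_law_Suc(1)[OF t ij(2) m x hi])
        (auto simp: space_prob_algebra prob_space.emeasure_space_1 intro!: nn_integral_cong)
    then show ?thesis
      using Suc.IH Suc.prems ij by simp
  qed simp
qed simp

lemma nn_integral_joint_law:
  fixes h :: "(nat \<Rightarrow> real) \<times> (nat \<Rightarrow> real) \<times> (nat \<Rightarrow> real) \<Rightarrow> ennreal"
  assumes \<sigma>: "\<sigma> > 0" and Rs: "Rs \<ge> 0" and f: "f \<in> encoders R Rs n" and g: "g \<in> decoders R Rs n"
    and t: "t \<in> causal_eavesdroppers R n"
    and h: "h \<in> borel_measurable (seq_space n \<Otimes>\<^sub>M seq_space n \<Otimes>\<^sub>M seq_space n)"
  shows "integral\<^sup>N (joint_law \<mu> \<sigma> Rs n f g t) h =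
    (\<integral>\<^sup>+x. \<integral>\<^sup>+k. \<integral>\<^sup>+m. \<integral>\<^sup>+y. \<integral>\<^sup>+z. h (x, y, z) \<partial>eve_law t m x n \<partial>PiM {..<n} (\<lambda>i. g i (m, k))
      \<partial>f (x, k) \<partial>uniform_count_measure (rate_set Rs n) \<partial>gaussian_source \<mu> \<sigma> n)"
    and "sets (joint_law \<mu> \<sigma> Rs n f g t) = sets (seq_space n \<Otimes>\<^sub>M seq_space n \<Otimes>\<^sub>M seq_space n)"
    and "prob_space (joint_law \<mu> \<sigma> Rs n f g t)"
proof -
  define S where "S = seq_space n"
  define K where "K = count_space (rate_set Rs n)"
  define C where "C = count_space (rate_set R n)"
  define T where "T = S \<Otimes>\<^sub>M S \<Otimes>\<^sub>M S"
  define unif where "unif = uniform_count_measure (rate_set Rs n)"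
  have f': "f \<in> S \<Otimes>\<^sub>M K \<rightarrow>\<^sub>M prob_algebra C"
    using f by (simp add: encoders_def S_def K_def C_def)
  have g': "(\<lambda>(m, k). PiM {..<n} (\<lambda>i. g i (m, k))) \<in> C \<Otimes>\<^sub>M K \<rightarrow>\<^sub>M prob_algebra S"
    unfolding S_def K_def C_def by (rule PiM_kernel_measurable[OF g])
  have e': "(\<lambda>(m, x). eve_law t m x n) \<in> C \<Otimes>\<^sub>M S \<rightarrow>\<^sub>M prob_algebra S"
    unfolding S_def C_def by (rule eve_law_measurable[OF t order_refl])
  \<comment> \<open>The tails of the sampling procedure, from the inside out, each taken as a kernel
    in the variables drawn before it. Measurability is built up from \<open>k4\<close> to
    \<open>k1\<close>; the integral is then unfolded in the opposite order.\<close>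
  define k4 where "k4 = (\<lambda>(((x, k :: nat), m), y). eve_law t m x n \<bind> (\<lambda>z. return T (x, y, z)))"
  define k3 where "k3 = (\<lambda>((x, k), m). PiM {..<n} (\<lambda>i. g i (m, k)) \<bind> (\<lambda>y. k4 (((x, k), m), y)))"
  define k2 where "k2 = (\<lambda>(x, k). f (x, k) \<bind> (\<lambda>m. k3 ((x, k), m)))"
  define k1 where "k1 = (\<lambda>x. unif \<bind> (\<lambda>k. k2 (x, k)))"
  have J: "joint_law \<mu> \<sigma> Rs n f g t = gaussian_source \<mu> \<sigma> n \<bind> k1"
    by (simp add: joint_law_def k1_def k2_def k3_def k4_def unif_def T_def S_def)
  have E4: "(\<lambda>q. eve_law t (snd (fst q)) (fst (fst (fst q))) n) \<in> ((S \<Otimes>\<^sub>M K) \<Otimes>\<^sub>M C) \<Otimes>\<^sub>M S \<rightarrow>\<^sub>M prob_algebra S"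
    using measurable_compose[OF _ e', of "\<lambda>q. (snd (fst q), fst (fst (fst q)))"
      "((S \<Otimes>\<^sub>M K) \<Otimes>\<^sub>M C) \<Otimes>\<^sub>M S"] by simp
  have R4: "(\<lambda>r. return T (fst (fst (fst (fst r))), snd (fst r), snd r))
      \<in> (((S \<Otimes>\<^sub>M K) \<Otimes>\<^sub>M C) \<Otimes>\<^sub>M S) \<Otimes>\<^sub>M S \<rightarrow>\<^sub>M prob_algebra T"
    unfolding T_def by measurable
  have K4: "k4 \<in> ((S \<Otimes>\<^sub>M K) \<Otimes>\<^sub>M C) \<Otimes>\<^sub>M S \<rightarrow>\<^sub>M prob_algebra T"
    unfolding k4_def split_beta'
    by (rule measurable_bind_prob_space2[OF E4]) (use R4 in \<open>simp add: split_beta'\<close>)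
  have G3: "(\<lambda>q. PiM {..<n} (\<lambda>i. g i (snd q, snd (fst q)))) \<in> (S \<Otimes>\<^sub>M K) \<Otimes>\<^sub>M C \<rightarrow>\<^sub>M prob_algebra S"
    using measurable_compose[OF _ g', of "\<lambda>q. (snd q, snd (fst q))"
      "(S \<Otimes>\<^sub>M K) \<Otimes>\<^sub>M C"] by simp
  have K3: "k3 \<in> (S \<Otimes>\<^sub>M K) \<Otimes>\<^sub>M C \<rightarrow>\<^sub>M prob_algebra T"
    unfolding k3_def split_beta'
    by (rule measurable_bind_prob_space2[OF G3]) (use K4 in \<open>simp add: split_beta'\<close>)
  have K2: "k2 \<in> S \<Otimes>\<^sub>M K \<rightarrow>\<^sub>M prob_algebra T"
    unfolding k2_def split_beta' prod.collapse
    by (rule measurable_bind_prob_space2[OF f']) (use K3 in \<open>simp add: split_beta'\<close>)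
  have su [measurable_cong]: "sets unif = sets K"
    by (simp add: unif_def K_def sets_uniform_count_measure)
  have pu: "prob_space unif"
    unfolding unif_def using rate_set_nonempty[OF Rs] by (intro prob_space_uniform_count_measure) auto
  have U: "unif \<in> space (prob_algebra K)"
    using su pu by (simp add: space_prob_algebra)
  have K1: "k1 \<in> S \<rightarrow>\<^sub>M prob_algebra T"
    unfolding k1_def
    by (rule measurable_bind_prob_space2[OF measurable_const[OF U]]) (use K2 in \<open>simp add: split_beta'\<close>)
  interpret G: prob_space "gaussian_source \<mu> \<sigma> n"
    by (rule prob_space_gaussian_source[OF \<sigma>])
  have G: "gaussian_source \<mu> \<sigma> n \<in> space (prob_algebra S)"
    using G.prob_space_axioms by (simp add: space_prob_algebra S_def)
  show "sets (joint_law \<mu> \<sigma> Rs n f g t) = sets (seq_space n \<Otimes>\<^sub>M seq_space n \<Otimes>\<^sub>M seq_space n)"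
    unfolding J using sets_bind'[OF G K1] by (simp add: T_def S_def)
  show "prob_space (joint_law \<mu> \<sigma> Rs n f g t)"
    unfolding J by (rule prob_space_bind'[OF G K1])
  have h: "h \<in> borel_measurable T"
    using h by (simp add: T_def S_def)
  have bind: "integral\<^sup>N (A \<bind> (\<lambda>b. k (a, b))) h = (\<integral>\<^sup>+b. integral\<^sup>N (k (a, b)) h \<partial>A)"
    if "k \<in> X \<Otimes>\<^sub>M Y \<rightarrow>\<^sub>M prob_algebra T" "a \<in> space X" "sets A = sets Y"
    for A :: "'c measure" and k :: "'b \<times> 'c \<Rightarrow> _" and X Y a
    by (rule nn_integral_bind[OF h])
      (use measurable_prob_algebraD[OF measurable_compose[OF measurable_Pair1'[OF that(2)] that(1)]] that(3)
        in \<open>simp cong: measurable_cong_sets\<close>)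
  have "integral\<^sup>N (joint_law \<mu> \<sigma> Rs n f g t) h = (\<integral>\<^sup>+x. integral\<^sup>N (k1 x) h \<partial>gaussian_source \<mu> \<sigma> n)"
    unfolding J by (rule nn_integral_bind[OF h])
      (use measurable_prob_algebraD[OF K1] in \<open>simp add: S_def cong: measurable_cong_sets\<close>)
  also have "\<dots> = (\<integral>\<^sup>+x. \<integral>\<^sup>+k. \<integral>\<^sup>+m. \<integral>\<^sup>+y. \<integral>\<^sup>+z. h (x, y, z) \<partial>eve_law t m x n \<partial>PiM {..<n} (\<lambda>i. g i (m, k))
      \<partial>f (x, k) \<partial>unif \<partial>gaussian_source \<mu> \<sigma> n)"
  proof (rule nn_integral_cong)
    fix x assume "x \<in> space (gaussian_source \<mu> \<sigma> n)"
    then have x: "x \<in> space S" by (simp add: S_def)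
    have "integral\<^sup>N (k1 x) h = (\<integral>\<^sup>+k. integral\<^sup>N (k2 (x, k)) h \<partial>unif)"
      unfolding k1_def by (rule bind[OF K2 x su])
    also have "\<dots> = (\<integral>\<^sup>+k. \<integral>\<^sup>+m. \<integral>\<^sup>+y. \<integral>\<^sup>+z. h (x, y, z) \<partial>eve_law t m x n \<partial>PiM {..<n} (\<lambda>i. g i (m, k))
      \<partial>f (x, k) \<partial>unif)"
    proof (rule nn_integral_cong)
      fix k assume "k \<in> space unif"
      then have xk: "(x, k) \<in> space (S \<Otimes>\<^sub>M K)"
        using x sets_eq_imp_space_eq[OF su] by (simp add: space_pair_measure)
      have F: "f (x, k) \<in> space (prob_algebra C)"
        using measurable_space[OF f' xk] .
      then have sf: "sets (f (x, k)) = sets C" by (simp add: space_prob_algebra)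
      have "integral\<^sup>N (k2 (x, k)) h = (\<integral>\<^sup>+m. integral\<^sup>N (k3 ((x, k), m)) h \<partial>f (x, k))"
        unfolding k2_def prod.case by (rule bind[OF K3 xk sf])
      also have "\<dots> = (\<integral>\<^sup>+m. \<integral>\<^sup>+y. \<integral>\<^sup>+z. h (x, y, z) \<partial>eve_law t m x n \<partial>PiM {..<n} (\<lambda>i. g i (m, k))
        \<partial>f (x, k))"
      proof (rule nn_integral_cong)
        fix m assume "m \<in> space (f (x, k))"
        then have m: "m \<in> space C" using sets_eq_imp_space_eq[OF sf] by simp
        then have xkm: "((x, k), m) \<in> space ((S \<Otimes>\<^sub>M K) \<Otimes>\<^sub>M C)"
          using xk by (simp add: space_pair_measure)
        have sg: "sets (PiM {..<n} (\<lambda>i. g i (m, k))) = sets S"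
          using measurable_space[OF G3 xkm] by (simp add: space_prob_algebra)
        have "integral\<^sup>N (k3 ((x, k), m)) h
          = (\<integral>\<^sup>+y. integral\<^sup>N (k4 (((x, k), m), y)) h \<partial>PiM {..<n} (\<lambda>i. g i (m, k)))"
          unfolding k3_def prod.case by (rule bind[OF K4 xkm sg])
        also have "\<dots> = (\<integral>\<^sup>+y. \<integral>\<^sup>+z. h (x, y, z) \<partial>eve_law t m x n \<partial>PiM {..<n} (\<lambda>i. g i (m, k)))"
        proof (rule nn_integral_cong)
          fix y assume "y \<in> space (PiM {..<n} (\<lambda>i. g i (m, k)))"
          then have y: "y \<in> space S" using sets_eq_imp_space_eq[OF sg] by simp
          then have q: "(((x, k), m), y) \<in> space (((S \<Otimes>\<^sub>M K) \<Otimes>\<^sub>M C) \<Otimes>\<^sub>M S)"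
            using xkm by (simp add: space_pair_measure)
          have se: "sets (eve_law t m x n) = sets S"
            using measurable_space[OF E4 q] by (simp add: space_prob_algebra)
          have "integral\<^sup>N (k4 (((x, k), m), y)) h
            = (\<integral>\<^sup>+z. integral\<^sup>N (return T (x, y, z)) h \<partial>eve_law t m x n)"
            unfolding k4_def prod.case
            using bind[OF R4 q se] by simp
          also have "\<dots> = (\<integral>\<^sup>+z. h (x, y, z) \<partial>eve_law t m x n)"
            using x y sets_eq_imp_space_eq[OF se] h
            by (intro nn_integral_cong nn_integral_return) (auto simp: T_def space_pair_measure)
          finally show "integral\<^sup>N (k4 (((x, k), m), y)) h = (\<integral>\<^sup>+z. h (x, y, z) \<partial>eve_law t m x n)" .
        qed
        finally show "integral\<^sup>N (k3 ((x, k), m)) h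
          = (\<integral>\<^sup>+y. \<integral>\<^sup>+z. h (x, y, z) \<partial>eve_law t m x n \<partial>PiM {..<n} (\<lambda>i. g i (m, k)))" .
      qed
      finally show "integral\<^sup>N (k2 (x, k)) h = (\<integral>\<^sup>+m. \<integral>\<^sup>+y. \<integral>\<^sup>+z. h (x, y, z) \<partial>eve_law t m x n
        \<partial>PiM {..<n} (\<lambda>i. g i (m, k)) \<partial>f (x, k))" .
    qed
    finally show "integral\<^sup>N (k1 x) h = (\<integral>\<^sup>+k. \<integral>\<^sup>+m. \<integral>\<^sup>+y. \<integral>\<^sup>+z. h (x, y, z) \<partial>eve_law t m x n
      \<partial>PiM {..<n} (\<lambda>i. g i (m, k)) \<partial>f (x, k) \<partial>unif)" .
  qed
  finally show "integral\<^sup>N (joint_law \<mu> \<sigma> Rs n f g t) h =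
    (\<integral>\<^sup>+x. \<integral>\<^sup>+k. \<integral>\<^sup>+m. \<integral>\<^sup>+y. \<integral>\<^sup>+z. h (x, y, z) \<partial>eve_law t m x n \<partial>PiM {..<n} (\<lambda>i. g i (m, k))
      \<partial>f (x, k) \<partial>uniform_count_measure (rate_set Rs n) \<partial>gaussian_source \<mu> \<sigma> n)"
    by (simp add: unif_def)
qed

section \<open>Extended expectation of a difference of nonnegative functions\<close>

text \<open>The pair \<open>a\<close>, \<open>b\<close> exceeds the positive and negative parts of
  \<open>a - b\<close> by the same function, the minimum of \<open>a\<close> and \<open>b\<close>.
  Hence the two differences of integrals agree once one of the integrals is finite and infinity
  minus infinity is excluded.\<close>

lemma ext_expectation_diff:
  assumes [measurable]: "a \<in> borel_measurable M" "b \<in> borel_measurable M"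
    and nonneg: "\<And>w. 0 \<le> a w" "\<And>w. 0 \<le> b w"
    and fin: "(\<integral>\<^sup>+w. ennreal (a w) \<partial>M) < \<infinity> \<or> (\<integral>\<^sup>+w. ennreal (b w) \<partial>M) < \<infinity>"
  shows "ext_expectation M (\<lambda>w. a w - b w)
    = enn2ereal (\<integral>\<^sup>+w. ennreal (a w) \<partial>M) - enn2ereal (\<integral>\<^sup>+w. ennreal (b w) \<partial>M)"
proof -
  define p where "p = (\<integral>\<^sup>+w. ennreal (a w - b w) \<partial>M)"
  define q where "q = (\<integral>\<^sup>+w. ennreal (- (a w - b w)) \<partial>M)"
  define A where "A = (\<integral>\<^sup>+w. ennreal (a w) \<partial>M)"
  define B where "B = (\<integral>\<^sup>+w. ennreal (b w) \<partial>M)"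
  have "p + B = (\<integral>\<^sup>+w. ennreal (a w - b w) + ennreal (b w) \<partial>M)"
    unfolding p_def B_def by (simp add: nn_integral_add)
  also have "\<dots> = (\<integral>\<^sup>+w. ennreal (- (a w - b w)) + ennreal (a w) \<partial>M)"
  proof (rule nn_integral_cong)
    fix w
    show "ennreal (a w - b w) + ennreal (b w) = ennreal (- (a w - b w)) + ennreal (a w)"
      using nonneg[of w]
      by (cases "a w \<le> b w") (simp_all add: ennreal_plus[symmetric] ennreal_neg del: ennreal_plus)
  qed
  also have "\<dots> = q + A"
    unfolding q_def A_def by (simp add: nn_integral_add)
  finally have eq: "p + B = q + A" .
  have "p \<le> A" "q \<le> B"
    unfolding p_def q_def A_def B_def using nonneg by (auto intro!: nn_integral_mono ennreal_leI)
  with eq fin have "enn2ereal p - enn2ereal q = enn2ereal A - enn2ereal B"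
    unfolding A_def[symmetric] B_def[symmetric]
    by (cases p; cases q; cases A; cases B)
      (auto simp: ennreal_plus[symmetric] enn2ereal_ennreal top_unique simp del: ennreal_plus)
  then show ?thesis
    by (simp add: ext_expectation_def p_def q_def A_def B_def)
qed

section \<open>Converse\<close>

lemma nn_integral_uniform_count_measure:
  assumes "finite A"
  shows "integral\<^sup>N (uniform_count_measure A) h = (\<Sum>k\<in>A. h k) / ennreal (real (card A))"
proof (cases "A = {}")
  case False
  then have c: "card A > 0" using assms by (simp add: card_gt_0_iff)
  have "integral\<^sup>N (uniform_count_measure A) h = (\<Sum>k\<in>A. h k * ennreal (1 / real (card A)))"
    using assms by (simp add: uniform_count_measure_def nn_integral_point_measure_finite mult.commute)
  also have "\<dots> = (\<Sum>k\<in>A. h k) * ennreal (1 / real (card A))"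
    by (rule sum_distrib_right[symmetric])
  also have "\<dots> = (\<Sum>k\<in>A. h k) / ennreal (real (card A))"
    using c by (simp add: divide_ennreal_def inverse_ennreal inverse_eq_divide)
  finally show ?thesis .
qed (simp add: uniform_count_measure_def point_measure_def nn_integral_density)

lemma space_eq_of_space_prob_algebra: "N \<in> space (prob_algebra M) \<Longrightarrow> space N = space M"
  by (rule sets_eq_imp_space_eq) (simp add: space_prob_algebra)

lemma encoder_space:
  assumes "f \<in> encoders R Rs n" "x \<in> space (seq_space n)" "k \<in> rate_set Rs n"
  shows "f (x, k) \<in> space (prob_algebra (count_space (rate_set R n)))"
  by (rule measurable_space[OF assms(1)[unfolded encoders_def]])
    (simp only: space_pair_measure mem_Times_iff fst_conv snd_conv space_count_space assms)

lemma decoder_space: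
  assumes "g \<in> decoders R Rs n" "m \<in> rate_set R n" "k \<in> rate_set Rs n"
  shows "PiM {..<n} (\<lambda>i. g i (m, k)) \<in> space (prob_algebra (seq_space n))"
  using measurable_space[OF PiM_kernel_measurable[OF assms(1)], of "(m, k)"] assms(2,3)
  by (simp add: space_pair_measure)

text \<open>The working form of the joint law: in each application the integrals over
  \<open>y\<close> and \<open>z\<close> can be evaluated for fixed source, key and message, and
  \<open>cong\<close> supplies their value \<open>H\<close>. What remains is an average over the key
  and the encoder's randomness.\<close>

lemma nn_integral_joint_law_sum:
  fixes h :: "(nat \<Rightarrow> real) \<times> (nat \<Rightarrow> real) \<times> (nat \<Rightarrow> real) \<Rightarrow> ennreal"
  assumes \<sigma>: "\<sigma> > 0" and Rs: "Rs \<ge> 0" and f: "f \<in> encoders R Rs n" and g: "g \<in> decoders R Rs n"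
    and t: "t \<in> causal_eavesdroppers R n"
    and h: "h \<in> borel_measurable (seq_space n \<Otimes>\<^sub>M seq_space n \<Otimes>\<^sub>M seq_space n)"
    and cong: "\<And>x k m. x \<in> space (seq_space n) \<Longrightarrow> k \<in> rate_set Rs n \<Longrightarrow> m \<in> rate_set R n \<Longrightarrow>
      (\<integral>\<^sup>+y. \<integral>\<^sup>+z. h (x, y, z) \<partial>eve_law t m x n \<partial>PiM {..<n} (\<lambda>i. g i (m, k))) = H x k m"
  shows "integral\<^sup>N (joint_law \<mu> \<sigma> Rs n f g t) h =
    (\<integral>\<^sup>+x. (\<Sum>k\<in>rate_set Rs n. \<integral>\<^sup>+m. H x k m \<partial>f (x, k)) / ennreal (real (card (rate_set Rs n)))
      \<partial>gaussian_source \<mu> \<sigma> n)"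
proof -
  have "(\<integral>\<^sup>+m. \<integral>\<^sup>+y. \<integral>\<^sup>+z. h (x, y, z) \<partial>eve_law t m x n \<partial>PiM {..<n} (\<lambda>i. g i (m, k)) \<partial>f (x, k))
      = (\<integral>\<^sup>+m. H x k m \<partial>f (x, k))" if "x \<in> space (seq_space n)" "k \<in> rate_set Rs n" for x k
  proof -
    have "space (f (x, k)) = rate_set R n"
      using space_eq_of_space_prob_algebra[OF encoder_space[OF f that]] by simp
    then show ?thesis using that cong by (intro nn_integral_cong) auto
  qed
  then show ?thesis
    unfolding nn_integral_joint_law(1)[OF \<sigma> Rs f g t h] nn_integral_uniform_count_measure[OF finite_rate_set]
    by - (rule nn_integral_cong, simp)
qed

lemma nn_integral_joint_law_source:
  assumes \<sigma>: "\<sigma> > 0" and Rs: "Rs \<ge> 0" and f: "f \<in> encoders R Rs n" and g: "g \<in> decoders R Rs n"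
    and t: "t \<in> causal_eavesdroppers R n" and \<phi>[measurable]: "\<phi> \<in> borel_measurable (seq_space n)"
  shows "(\<integral>\<^sup>+(x, y, z). \<phi> x \<partial>joint_law \<mu> \<sigma> Rs n f g t) = (\<integral>\<^sup>+x. \<phi> x \<partial>gaussian_source \<mu> \<sigma> n)"
proof -
  have c: "card (rate_set Rs n) > 0"
    using rate_set_nonempty[OF Rs] by (simp add: card_gt_0_iff)
  have "(\<integral>\<^sup>+(x, y, z). \<phi> x \<partial>joint_law \<mu> \<sigma> Rs n f g t) =
    (\<integral>\<^sup>+x. (\<Sum>k\<in>rate_set Rs n. \<integral>\<^sup>+m. \<phi> x \<partial>f (x, k)) / ennreal (real (card (rate_set Rs n)))
      \<partial>gaussian_source \<mu> \<sigma> n)"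
  proof (rule nn_integral_joint_law_sum[OF \<sigma> Rs f g t])
    fix x k m assume "x \<in> space (seq_space n)" "k \<in> rate_set Rs n" "m \<in> rate_set R n"
    then show "(\<integral>\<^sup>+y. \<integral>\<^sup>+z. (case (x, y, z) of (x, y, z) \<Rightarrow> \<phi> x) \<partial>eve_law t m x n
        \<partial>PiM {..<n} (\<lambda>i. g i (m, k))) = \<phi> x"
      using decoder_space[OF g, of m k] eve_law_space[OF t order_refl, of m x]
      by (simp add: space_prob_algebra prob_space.emeasure_space_1)
  qed measurable
  also have "\<dots> = (\<integral>\<^sup>+x. \<phi> x \<partial>gaussian_source \<mu> \<sigma> n)"
  proof (rule nn_integral_cong)
    fix x assume "x \<in> space (gaussian_source \<mu> \<sigma> n)"
    then have "(\<integral>\<^sup>+m. \<phi> x \<partial>f (x, k)) = \<phi> x" if "k \<in> rate_set Rs n" for k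
      using encoder_space[OF f _ that, of x] by (simp add: space_prob_algebra prob_space.emeasure_space_1)
    then have "(\<Sum>k\<in>rate_set Rs n. \<integral>\<^sup>+m. \<phi> x \<partial>f (x, k)) = of_nat (card (rate_set Rs n)) * \<phi> x"
      by simp
    then show "(\<Sum>k\<in>rate_set Rs n. \<integral>\<^sup>+m. \<phi> x \<partial>f (x, k)) / ennreal (real (card (rate_set Rs n))) = \<phi> x"
      using c rate_set_nonempty[OF Rs] by (simp add: ennreal_of_nat_eq_real_of_nat mult.commute[of _ "\<phi> x"] ennreal_times_divide[symmetric]
          divide_ennreal)
  qed
  finally show ?thesis .
qed

lemma nn_integral_gaussian_source_component:
  assumes \<sigma>: "\<sigma> > 0" and "i < n" and "h \<in> borel_measurable borel"
  shows "(\<integral>\<^sup>+x. h (x i) \<partial>gaussian_source \<mu> \<sigma> n) = (\<integral>\<^sup>+x. h x \<partial>gauss \<mu> \<sigma>)"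
proof -
  have "(\<integral>\<^sup>+x. h x \<partial>gauss \<mu> \<sigma>)
    = (\<integral>\<^sup>+x. h x \<partial>distr (PiM {..<n} (\<lambda>_. gauss \<mu> \<sigma>)) (gauss \<mu> \<sigma>) (\<lambda>x. x i))"
    using assms prob_space_normal_density[OF \<sigma>] by (subst distr_PiM_component) auto
  also have "\<dots> = (\<integral>\<^sup>+x. h (x i) \<partial>gaussian_source \<mu> \<sigma> n)"
    unfolding gaussian_source_def using assms by (subst nn_integral_distr) auto
  finally show ?thesis ..
qed

lemma nn_integral_gaussian_source_square:
  assumes "\<sigma> > 0" "i < n"
  shows "(\<integral>\<^sup>+x. ennreal ((x i - \<mu>)\<^sup>2) \<partial>gaussian_source \<mu> \<sigma> n) = ennreal (\<sigma>\<^sup>2)"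
  using nn_integral_gaussian_source_component[OF assms, of "\<lambda>x. ennreal ((x - \<mu>)\<^sup>2)"]
  by (simp add: nn_integral_gauss_square assms)

lemma nn_integral_gaussian_source_tilted:
  assumes s: "\<sigma> > 0" and d: "d > 0"
  shows "(\<integral>\<^sup>+x. ennreal (exp (\<Sum>i<n. (x i - \<mu>)\<^sup>2 / (2 * \<sigma>\<^sup>2) - (x i - y i)\<^sup>2 / (2 * \<sigma>\<^sup>2 * d)))
    \<partial>gaussian_source \<mu> \<sigma> n) = ennreal (sqrt d ^ n)"
proof -
  interpret product_prob_space "\<lambda>_. gauss \<mu> \<sigma>" "{..<n}"
    by (rule product_prob_spaceI) (rule prob_space_normal_density[OF s])
  show ?thesis
    unfolding gaussian_source_def exp_sum[OF finite_lessThan] prod_ennreal[OF exp_ge_zero, symmetric]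
    by (subst product_nn_integral_prod)
      (use s d in \<open>simp_all add: nn_integral_gauss_tilted prod_ennreal[symmetric] ennreal_power\<close>)
qed

text \<open>The Shannon lower bound without entropies: the right-hand side of \<open>1 + W \<le> exp W\<close> is
  averaged over the message by summing over all messages, whatever the encoder.\<close>

lemma distortion_ge:
  assumes \<sigma>: "\<sigma> > 0" and R: "R \<ge> 0" and Rs: "Rs \<ge> 0" and n: "n > 0"
    and f: "f \<in> encoders R Rs n" and g: "g \<in> decoders R Rs n" and t: "t \<in> causal_eavesdroppers R n"
  shows "ennreal (2 powr (- 2 * R)) \<le>
    (\<integral>\<^sup>+(x, y, z). ennreal ((\<Sum>i<n. (y i - x i)\<^sup>2) / (\<sigma>\<^sup>2 * n)) \<partial>joint_law \<mu> \<sigma> Rs n f g t)"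
proof -
  \<comment> \<open>The normalised distortion claimed as lower bound. Its root is 2 powr (- R), so
    that \<open>sqrt d ^ n\<close> times the number of messages is at most 1.\<close>
  define d where "d = 2 powr (- 2 * R)"
  have d: "d > 0" "sqrt d = 2 powr (- R)"
    by (simp_all add: d_def powr_half_sqrt[symmetric] powr_powr)
  define J where "J = joint_law \<mu> \<sigma> Rs n f g t"
  \<comment> \<open>Up to an additive constant, the log-likelihood ratio of the Gaussian with mean
    \<open>y\<close> and variance \<open>\<sigma>\<^sup>2 * d\<close> against the source law, summed
    over the coordinates.\<close>
  define W where "W x y = (\<Sum>i<n. (x i - \<mu>)\<^sup>2 / (2 * \<sigma>\<^sup>2) - (x i - y i)\<^sup>2 / (2 * \<sigma>\<^sup>2 * d))"
    for x y :: "nat \<Rightarrow> real"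
  let ?S = "seq_space n"
  have sJ [measurable_cong]: "sets J = sets (?S \<Otimes>\<^sub>M ?S \<Otimes>\<^sub>M ?S)" and pJ: "prob_space J"
    unfolding J_def using nn_integral_joint_law[OF \<sigma> Rs f g t, of "\<lambda>_. 0"] by auto
  have Wm [measurable]: "(\<lambda>p. W (fst p) (snd p)) \<in> borel_measurable (?S \<Otimes>\<^sub>M ?S)"
    unfolding W_def by measurable
  have [measurable]: "(\<lambda>p. W (snd p) (fst p)) \<in> borel_measurable (?S \<Otimes>\<^sub>M ?S)"
    unfolding W_def by measurable
  have [measurable]: "(\<lambda>p. W (fst p) (fst (snd p))) \<in> borel_measurable (?S \<Otimes>\<^sub>M ?S \<Otimes>\<^sub>M ?S)"
    unfolding W_def by measurable
  define \<phi> where "\<phi> x k m = (\<integral>\<^sup>+y. ennreal (exp (W x y)) \<partial>PiM {..<n} (\<lambda>i. g i (m, k)))" for x k m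
  have card_pos: "card (rate_set Rs n) > 0"
    using rate_set_nonempty[OF Rs] by (simp add: card_gt_0_iff)
  \<comment> \<open>With message and key fixed, the reconstruction is independent of the source, so
    the source can be integrated first. There the tilted integral has the same value for every
    \<open>y\<close>.\<close>
  have \<phi>: "(\<lambda>x. \<phi> x k m) \<in> borel_measurable (gaussian_source \<mu> \<sigma> n)"
    "(\<integral>\<^sup>+x. \<phi> x k m \<partial>gaussian_source \<mu> \<sigma> n) = ennreal (sqrt d ^ n)"
    if "k \<in> rate_set Rs n" "m \<in> rate_set R n" for k m
  proof -
    have P: "PiM {..<n} (\<lambda>i. g i (m, k)) \<in> space (prob_algebra ?S)"
      using decoder_space[OF g] that by simp
    then have [measurable_cong]: "sets (PiM {..<n} (\<lambda>i. g i (m, k))) = sets ?S"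
      by (simp add: space_prob_algebra)
    interpret P: prob_space "PiM {..<n} (\<lambda>i. g i (m, k))"
      using P by (simp add: space_prob_algebra)
    interpret G: prob_space "gaussian_source \<mu> \<sigma> n"
      by (rule prob_space_gaussian_source[OF \<sigma>])
    interpret PG: pair_sigma_finite "PiM {..<n} (\<lambda>i. g i (m, k))" "gaussian_source \<mu> \<sigma> n" ..
    show "(\<lambda>x. \<phi> x k m) \<in> borel_measurable (gaussian_source \<mu> \<sigma> n)"
      unfolding \<phi>_def by measurable
    have "(\<integral>\<^sup>+x. \<phi> x k m \<partial>gaussian_source \<mu> \<sigma> n)
      = (\<integral>\<^sup>+y. \<integral>\<^sup>+x. ennreal (exp (W x y)) \<partial>gaussian_source \<mu> \<sigma> n \<partial>PiM {..<n} (\<lambda>i. g i (m, k)))"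
      unfolding \<phi>_def by (rule PG.Fubini') measurable
    also have "\<dots> = ennreal (sqrt d ^ n)"
      unfolding W_def nn_integral_gaussian_source_tilted[OF \<sigma> d(1)]
      by (simp add: P.emeasure_space_1)
    finally show "(\<integral>\<^sup>+x. \<phi> x k m \<partial>gaussian_source \<mu> \<sigma> n) = ennreal (sqrt d ^ n)" .
  qed
  have "(\<integral>\<^sup>+(x, y, z). ennreal (exp (W x y)) \<partial>J)
    = (\<integral>\<^sup>+x. (\<Sum>k\<in>rate_set Rs n. \<integral>\<^sup>+m. \<phi> x k m \<partial>f (x, k)) / ennreal (real (card (rate_set Rs n)))
      \<partial>gaussian_source \<mu> \<sigma> n)"
    unfolding J_def
  proof (rule nn_integral_joint_law_sum[OF \<sigma> Rs f g t])
    fix x k m assume "x \<in> space (seq_space n)" "k \<in> rate_set Rs n" "m \<in> rate_set R n"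
    then show "(\<integral>\<^sup>+y. \<integral>\<^sup>+z. (case (x, y, z) of (x, y, z) \<Rightarrow> ennreal (exp (W x y))) \<partial>eve_law t m x n
        \<partial>PiM {..<n} (\<lambda>i. g i (m, k))) = \<phi> x k m"
      using eve_law_space[OF t order_refl, of m x]
      by (simp add: space_prob_algebra prob_space.emeasure_space_1 \<phi>_def)
  qed measurable
  \<comment> \<open>The message depends on the source. Replacing its average by the sum over all
    messages removes this dependence, at the price of the factor
    \<open>card (rate_set R n)\<close>.\<close>
  also have "\<dots> \<le> (\<integral>\<^sup>+x. (\<Sum>k\<in>rate_set Rs n. \<Sum>m\<in>rate_set R n. \<phi> x k m)
      / ennreal (real (card (rate_set Rs n))) \<partial>gaussian_source \<mu> \<sigma> n)"
  proof (intro nn_integral_mono divide_right_mono_ennreal sum_mono)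
    fix x k assume "x \<in> space (gaussian_source \<mu> \<sigma> n)" "k \<in> rate_set Rs n"
    then have F: "f (x, k) \<in> space (prob_algebra (count_space (rate_set R n)))"
      using encoder_space[OF f] by simp
    then have sp: "space (f (x, k)) = rate_set R n"
      using space_eq_of_space_prob_algebra[OF F] by simp
    have "(\<integral>\<^sup>+m. \<phi> x k m \<partial>f (x, k)) \<le> (\<integral>\<^sup>+m. (\<Sum>m\<in>rate_set R n. \<phi> x k m) \<partial>f (x, k))"
      by (intro nn_integral_mono) (auto simp: sp intro!: member_le_sum)
    then show "(\<integral>\<^sup>+m. \<phi> x k m \<partial>f (x, k)) \<le> (\<Sum>m\<in>rate_set R n. \<phi> x k m)"
      using F by (simp add: space_prob_algebra prob_space.emeasure_space_1)
  qed
  also have "\<dots> = (\<Sum>k\<in>rate_set Rs n. \<Sum>m\<in>rate_set R n. ennreal (sqrt d ^ n))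
      / ennreal (real (card (rate_set Rs n)))"
    using \<phi> by (simp add: nn_integral_divide nn_integral_sum)
  also have "\<dots> = ennreal (real (card (rate_set R n)) * sqrt d ^ n)"
    using card_pos d(1) rate_set_nonempty[OF Rs]
    by (simp add: ennreal_of_nat_eq_real_of_nat ennreal_mult'' [symmetric] divide_ennreal)
  also have "\<dots> \<le> ennreal 1"
  proof (rule ennreal_leI)
    have "real (card (rate_set R n)) \<le> 2 powr (real n * R)"
      by (simp add: rate_set_def)
    then have "real (card (rate_set R n)) * sqrt d ^ n \<le> 2 powr (real n * R) * (2 powr (- R)) ^ n"
      unfolding d(2) by (intro mult_right_mono) auto
    also have "\<dots> = 1"
      by (simp add: powr_realpow[symmetric] powr_powr powr_add[symmetric] mult.commute)
    finally show "real (card (rate_set R n)) * sqrt d ^ n \<le> 1" .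
  qed
  finally have exp_le: "(\<integral>\<^sup>+(x, y, z). ennreal (exp (W x y)) \<partial>J) \<le> 1" by simp

  define D where "D x y = (\<Sum>i<n. (y i - x i)\<^sup>2) / (\<sigma>\<^sup>2 * n)" for x y :: "nat \<Rightarrow> real"
  have [measurable]: "(\<lambda>p. D (fst p) (snd p)) \<in> borel_measurable (?S \<Otimes>\<^sub>M ?S)"
    unfolding D_def by measurable
  have [measurable]: "(\<lambda>p. D (fst p) (fst (snd p))) \<in> borel_measurable (?S \<Otimes>\<^sub>M ?S \<Otimes>\<^sub>M ?S)"
    unfolding D_def by measurable
  have D0: "0 \<le> D x y" for x y unfolding D_def by (intro divide_nonneg_nonneg sum_nonneg) auto
  \<comment> \<open>With this factor, \<open>c * D x y\<close> is exactly the quadratic term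
    subtracted in \<open>W\<close>. The mean of 1 + W \<le> exp W then reads 1 + n / 2 - c * E D
    \<le> 1, that is, E D \<ge> d.\<close>
  define c where "c = real n / (2 * d)"
  have c: "c > 0" using n d by (simp add: c_def)
  have half: "ennreal (1 / (2 * \<sigma>\<^sup>2)) * (\<integral>\<^sup>+x. ennreal ((x i - \<mu>)\<^sup>2) \<partial>gaussian_source \<mu> \<sigma> n) = ennreal (1 / 2)"
    if "i < n" for i
    using that \<sigma> by (simp only: nn_integral_gaussian_source_square) (subst ennreal_mult[symmetric], auto)
  have "ennreal (1 + real n / 2) = ennreal 1 + ennreal (real n * (1 / 2))"
    by (subst ennreal_plus[symmetric]) (auto simp del: ennreal_plus)
  also have "\<dots> = 1 + (\<Sum>i<n. ennreal (1 / (2 * \<sigma>\<^sup>2)) * (\<integral>\<^sup>+x. ennreal ((x i - \<mu>)\<^sup>2) \<partial>gaussian_source \<mu> \<sigma> n))"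
  proof -
    have "(\<Sum>i<n. ennreal (1 / (2 * \<sigma>\<^sup>2)) * (\<integral>\<^sup>+x. ennreal ((x i - \<mu>)\<^sup>2) \<partial>gaussian_source \<mu> \<sigma> n))
      = (\<Sum>i<n. ennreal (1 / 2))"
      using half by (intro sum.cong refl) simp
    also have "\<dots> = ennreal (\<Sum>i<n. 1 / 2)"
      by (rule sum_ennreal) simp
    finally show ?thesis by simp
  qed
  also have "\<dots> = 1 + (\<integral>\<^sup>+x. (\<Sum>i<n. ennreal (1 / (2 * \<sigma>\<^sup>2)) * ennreal ((x i - \<mu>)\<^sup>2)) \<partial>gaussian_source \<mu> \<sigma> n)"
    by (subst nn_integral_sum) (auto simp: nn_integral_cmult)
  also have "\<dots> = 1 + (\<integral>\<^sup>+x. ennreal (\<Sum>i<n. (x i - \<mu>)\<^sup>2 / (2 * \<sigma>\<^sup>2)) \<partial>gaussian_source \<mu> \<sigma> n)"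
    by (simp add: ennreal_mult[symmetric])
  also have "\<dots> = (\<integral>\<^sup>+(x, y, z). 1 \<partial>J) + (\<integral>\<^sup>+(x, y, z). ennreal (\<Sum>i<n. (x i - \<mu>)\<^sup>2 / (2 * \<sigma>\<^sup>2)) \<partial>J)"
    unfolding J_def using pJ
    by (subst nn_integral_joint_law_source[OF \<sigma> Rs f g t])
      (auto simp: J_def split_beta' prob_space.emeasure_space_1)
  also have "\<dots> = (\<integral>\<^sup>+(x, y, z). ennreal (1 + (\<Sum>i<n. (x i - \<mu>)\<^sup>2 / (2 * \<sigma>\<^sup>2))) \<partial>J)"
    by (subst nn_integral_add[symmetric]) (auto simp: split_beta' sum_nonneg)
  \<comment> \<open>The subtracted term of \<open>W\<close> stands on the right-hand side, so that
    all integrands are nonnegative and a decoder without second moments is covered too.\<close>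
  also have "\<dots> \<le> (\<integral>\<^sup>+(x, y, z). ennreal c * ennreal (D x y) + ennreal (exp (W x y)) \<partial>J)"
  proof (intro nn_integral_mono, clarify)
    fix x y z :: "nat \<Rightarrow> real"
    have "c * D x y = (\<Sum>i<n. (x i - y i)\<^sup>2 / (2 * \<sigma>\<^sup>2 * d))"
      using n \<sigma> d by (simp add: c_def D_def sum_divide_distrib[symmetric] power2_commute field_simps)
    then have "1 + (\<Sum>i<n. (x i - \<mu>)\<^sup>2 / (2 * \<sigma>\<^sup>2)) = c * D x y + (1 + W x y)"
      by (simp add: W_def sum_subtractf)
    also have "\<dots> \<le> c * D x y + exp (W x y)"
      using exp_ge_add_one_self[of "W x y"] by linarith
    finally show "ennreal (1 + (\<Sum>i<n. (x i - \<mu>)\<^sup>2 / (2 * \<sigma>\<^sup>2))) \<le> ennreal c * ennreal (D x y) + ennreal (exp (W x y))"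
      using c D0[of x y] by (simp add: ennreal_mult[symmetric] ennreal_plus[symmetric] del: ennreal_plus)
  qed
  also have "\<dots> = ennreal c * (\<integral>\<^sup>+(x, y, z). ennreal (D x y) \<partial>J) + (\<integral>\<^sup>+(x, y, z). ennreal (exp (W x y)) \<partial>J)"
    by (simp add: split_beta' nn_integral_add nn_integral_cmult)
  also have "\<dots> \<le> ennreal c * (\<integral>\<^sup>+(x, y, z). ennreal (D x y) \<partial>J) + 1"
    using exp_le by (intro add_left_mono)
  finally have *: "ennreal (1 + real n / 2) \<le> ennreal c * (\<integral>\<^sup>+(x, y, z). ennreal (D x y) \<partial>J) + 1" .
  have "ennreal d \<le> (\<integral>\<^sup>+(x, y, z). ennreal (D x y) \<partial>J)"
  proof (cases "\<integral>\<^sup>+(x, y, z). ennreal (D x y) \<partial>J")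
    case (real r)
    then have "1 + real n / 2 \<le> c * r + 1"
      using * c by (simp add: ennreal_mult[symmetric] ennreal_1[symmetric] ennreal_plus[symmetric]
          del: ennreal_plus ennreal_1)
    then have "d \<le> r" using d n by (simp add: c_def field_simps)
    with real show ?thesis by (simp add: ennreal_leI)
  qed simp
  then show ?thesis by (simp add: d_def D_def J_def)
qed

section \<open>The payoff as a difference of two normalised squared errors, and the upper
  bound\<close>

lemma block_payoff_eq:
  "block_payoff \<sigma> n = (\<lambda>w. (\<Sum>i<n. (snd (snd w) i - fst w i)\<^sup>2) / (\<sigma>\<^sup>2 * n)
    - (\<Sum>i<n. (fst (snd w) i - fst w i)\<^sup>2) / (\<sigma>\<^sup>2 * n))"
  by (auto simp: fun_eq_iff block_payoff_def payoff_def split_beta' diff_divide_distrib sum_subtractf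
      sum_divide_distrib[symmetric])

lemma ext_expectation_block_payoff:
  fixes \<mu> :: real
  assumes \<sigma>: "\<sigma> > 0" and Rs: "Rs \<ge> 0" and f: "f \<in> encoders R Rs n" and g: "g \<in> decoders R Rs n"
    and t: "t \<in> causal_eavesdroppers R n"
  defines "A \<equiv> (\<integral>\<^sup>+(x, y, z). ennreal ((\<Sum>i<n. (z i - x i)\<^sup>2) / (\<sigma>\<^sup>2 * n)) \<partial>joint_law \<mu> \<sigma> Rs n f g t)"
    and "B \<equiv> (\<integral>\<^sup>+(x, y, z). ennreal ((\<Sum>i<n. (y i - x i)\<^sup>2) / (\<sigma>\<^sup>2 * n)) \<partial>joint_law \<mu> \<sigma> Rs n f g t)"
  assumes fin: "A < \<infinity> \<or> B < \<infinity>"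
  shows "ext_expectation (joint_law \<mu> \<sigma> Rs n f g t) (block_payoff \<sigma> n) = enn2ereal A - enn2ereal B"
proof -
  have sJ [measurable_cong]: "sets (joint_law \<mu> \<sigma> Rs n f g t)
      = sets (seq_space n \<Otimes>\<^sub>M seq_space n \<Otimes>\<^sub>M seq_space n)"
    using nn_integral_joint_law(2)[OF \<sigma> Rs f g t, of "\<lambda>_. 0"] by auto
  show ?thesis
    unfolding block_payoff_eq A_def B_def split_beta'
    by (rule ext_expectation_diff) (use fin in \<open>auto simp: A_def B_def split_beta' intro!: sum_nonneg divide_nonneg_nonneg\<close>)
qed

lemma nn_integral_block_error:
  assumes \<sigma>: "\<sigma> > 0" and [measurable_cong]: "sets J = sets (seq_space n \<Otimes>\<^sub>M seq_space n \<Otimes>\<^sub>M seq_space n)"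
  shows "(\<integral>\<^sup>+(x, y, z). ennreal ((\<Sum>i<n. (z i - x i)\<^sup>2) / (\<sigma>\<^sup>2 * n)) \<partial>J)
    = (\<Sum>i<n. \<integral>\<^sup>+(x, y, z). ennreal ((z i - x i)\<^sup>2) \<partial>J) / ennreal (\<sigma>\<^sup>2 * n)"
proof (cases "n = 0")
  case False
  then have "ennreal ((\<Sum>i<n. (z i - x i)\<^sup>2) / (\<sigma>\<^sup>2 * n))
      = (\<Sum>i<n. ennreal ((z i - x i)\<^sup>2)) / ennreal (\<sigma>\<^sup>2 * n)" for x z :: "nat \<Rightarrow> real"
    using \<sigma> by (subst sum_ennreal) (auto simp: sum_nonneg divide_ennreal)
  then show ?thesis
    by (simp add: split_beta' nn_integral_divide nn_integral_sum del: sum_ennreal)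
qed (simp add: split_beta')

lemma game_value_le:
  assumes \<sigma>: "\<sigma> > 0" and R: "R \<ge> 0" and Rs: "Rs \<ge> 0" and n: "n > 0"
  shows "game_value \<mu> \<sigma> R Rs n \<le> ereal (1 - 2 powr (- 2 * R))"
  unfolding game_value_def
proof (rule SUP_least, clarify)
  fix f g assume f: "f \<in> encoders R Rs n" and g: "g \<in> decoders R Rs n"
  define t where "t = (\<lambda>(i :: nat) (p :: nat \<times> (nat \<Rightarrow> real) \<times> (nat \<Rightarrow> real)). return borel \<mu>)"
  have t: "t \<in> causal_eavesdroppers R n"
    by (auto simp: t_def causal_eavesdroppers_def space_prob_algebra intro!: measurable_const prob_space_return)
  define J where "J = joint_law \<mu> \<sigma> Rs n f g t"
  have sJ: "sets J = sets (seq_space n \<Otimes>\<^sub>M seq_space n \<Otimes>\<^sub>M seq_space n)"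
    unfolding J_def using nn_integral_joint_law(2)[OF \<sigma> Rs f g t, of "\<lambda>_. 0"] by auto
  define A where "A = (\<integral>\<^sup>+(x, y, z). ennreal ((\<Sum>i<n. (z i - x i)\<^sup>2) / (\<sigma>\<^sup>2 * n)) \<partial>J)"
  define B where "B = (\<integral>\<^sup>+(x, y, z). ennreal ((\<Sum>i<n. (y i - x i)\<^sup>2) / (\<sigma>\<^sup>2 * n)) \<partial>J)"
  have one: "(\<integral>\<^sup>+(x, y, z). ennreal ((z i - x i)\<^sup>2) \<partial>J) = ennreal (\<sigma>\<^sup>2)" if i: "i < n" for i
  proof -
    have i': "i \<in> {..<n}" using i by simp
    have eve: "(\<integral>\<^sup>+z. ennreal ((z i - u)\<^sup>2) \<partial>eve_law t m x n) = ennreal ((u - \<mu>)\<^sup>2)"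
      if m: "m \<in> rate_set R n" and x: "x \<in> space (seq_space n)" for m x u
    proof -
      have meas: "(\<lambda>z. ennreal ((z i - u)\<^sup>2)) \<in> borel_measurable (seq_space (Suc i))"
        by measurable
      have "(\<integral>\<^sup>+z. ennreal ((z i - u)\<^sup>2) \<partial>eve_law t m x n)
        = (\<integral>\<^sup>+z. ennreal ((z i - u)\<^sup>2) \<partial>eve_law t m x (Suc i))"
        using i by (intro nn_integral_eve_law_component[OF t m x]) auto
      also have "\<dots> = (\<integral>\<^sup>+z. ennreal ((u - \<mu>)\<^sup>2) \<partial>eve_law t m x i)"
        by (subst nn_integral_eve_law_Suc(1)[OF t i m x meas])
          (simp add: t_def nn_integral_return power2_commute)
      also have "\<dots> = ennreal ((u - \<mu>)\<^sup>2)"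
        using eve_law_space[OF t less_imp_le[OF i] m x]
        by (simp add: space_prob_algebra prob_space.emeasure_space_1)
      finally show ?thesis .
    qed
    have y: "emeasure (PiM {..<n} (\<lambda>i. g i (m, k))) (space (PiM {..<n} (\<lambda>i. g i (m, k)))) = 1"
      if "m \<in> rate_set R n" "k \<in> rate_set Rs n" for m k
      using decoder_space[OF g that] by (simp add: space_prob_algebra prob_space.emeasure_space_1)
    have z: "emeasure (eve_law t m x n) (space (eve_law t m x n)) = 1"
      if "m \<in> rate_set R n" "x \<in> space (seq_space n)" for m x
      using eve_law_space[OF t order_refl that] by (simp add: space_prob_algebra prob_space.emeasure_space_1)
    let ?H = "\<lambda>x k m. ennreal ((x i - \<mu>)\<^sup>2)"
    have "(\<integral>\<^sup>+(x, y, z). ennreal ((z i - x i)\<^sup>2) \<partial>J)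
      = (\<integral>\<^sup>+x. (\<Sum>k\<in>rate_set Rs n. \<integral>\<^sup>+m. ?H x k m \<partial>f (x, k)) / ennreal (real (card (rate_set Rs n)))
        \<partial>gaussian_source \<mu> \<sigma> n)"
      unfolding J_def
      by (rule nn_integral_joint_law_sum[OF \<sigma> Rs f g t]) (use i' in \<open>simp_all add: eve y split_beta'\<close>)
    \<comment> \<open>Once \<open>z i\<close> has been replaced by the mean, the same averaged form
      is read backwards. It becomes an expectation that involves the source alone.\<close>
    also have "\<dots> = (\<integral>\<^sup>+(x, y, z). ennreal ((x i - \<mu>)\<^sup>2) \<partial>J)"
      unfolding J_def
      by (rule nn_integral_joint_law_sum[OF \<sigma> Rs f g t, symmetric]) (use i' in \<open>simp_all add: y z split_beta'\<close>)
    finally have "(\<integral>\<^sup>+(x, y, z). ennreal ((z i - x i)\<^sup>2) \<partial>J) = (\<integral>\<^sup>+(x, y, z). ennreal ((x i - \<mu>)\<^sup>2) \<partial>J)" .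
    then show ?thesis
      unfolding J_def using i'
      by (simp add: nn_integral_joint_law_source[OF \<sigma> Rs f g t] nn_integral_gaussian_source_square \<sigma>)
  qed
  have "A = ennreal 1"
    using n \<sigma> unfolding A_def nn_integral_block_error[OF \<sigma> sJ]
    by (simp add: one ennreal_of_nat_eq_real_of_nat ennreal_mult[symmetric] divide_ennreal mult.commute)
  moreover have "ennreal (2 powr (- 2 * R)) \<le> B"
    unfolding B_def J_def by (rule distortion_ge[OF \<sigma> R Rs n f g t])
  moreover have "ext_expectation J (block_payoff \<sigma> n) = enn2ereal A - enn2ereal B"
    using \<open>A = ennreal 1\<close> unfolding J_def A_def B_def
    by (intro ext_expectation_block_payoff[OF \<sigma> Rs f g t]) auto
  ultimately have "ext_expectation J (block_payoff \<sigma> n) \<le> ereal (1 - 2 powr (- 2 * R))"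
    by (cases B) (auto simp: enn2ereal_ennreal one_ennreal.rep_eq one_ereal_def)
  then show "(INF t\<in>causal_eavesdroppers R n. ext_expectation (joint_law \<mu> \<sigma> Rs n f g t) (block_payoff \<sigma> n))
    \<le> ereal (1 - 2 powr (- 2 * R))"
    using t by (intro INF_lower2[OF t]) (simp add: J_def)
qed

section \<open>Masking the signs\<close>

lemma distr_gauss_affine':
  assumes "s > 0" "b \<noteq> 0" "a + b * m = m'" "\<bar>b\<bar> * s = s'"
  shows "distr (gauss m s) (gauss m' s') (\<lambda>x. a + b * x) = gauss m' s'"
proof -
  have "distr (gauss m s) (gauss m' s') (\<lambda>x. a + b * x) = distr (gauss m s) borel (\<lambda>x. a + b * x)"
    by (rule distr_cong) simp_all
  then show ?thesis using distr_gauss_affine[OF assms(1,2), of m a] assms(3,4) by simp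
qed

text \<open>Serves two maps: the standardisation with signs, and the reflection of a single
  coordinate about the mean.\<close>

lemma distr_gaussian_source_affine:
  assumes s: "s > 0" "s' > 0" and b: "\<And>i. i < n \<Longrightarrow> b i \<noteq> 0" "\<And>i. i < n \<Longrightarrow> a i + b i * m = m'"
    "\<And>i. i < n \<Longrightarrow> \<bar>b i\<bar> * s = s'"
  shows "distr (gaussian_source m s n) (gaussian_source m' s' n) (\<lambda>x. \<lambda>i\<in>{..<n}. a i + b i * x i)
    = gaussian_source m' s' n"
proof -
  \<comment> \<open>Outside the block the coefficients are filled in so that the map still carries
    one normal law to the other; \<open>distr_PiM_componentwise\<close> asks for this at every
    index.\<close>
  define b' where "b' i = (if i < n then b i else s' / s)" for i
  define a' where "a' i = (if i < n then a i else m' - s' / s * m)" for i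
  have d: "distr (gauss m s) (gauss m' s') (\<lambda>x. a' i + b' i * x) = gauss m' s'" for i
    by (rule distr_gauss_affine') (use s b in \<open>auto simp: a'_def b'_def\<close>)
  have "distr (PiM {..<n} (\<lambda>_. gauss m s)) (PiM {..<n} (\<lambda>_. gauss m' s')) (\<lambda>x. \<lambda>i\<in>{..<n}. a' i + b' i * x i)
    = PiM {..<n} (\<lambda>_. gauss m' s')"
    by (rule distr_PiM_componentwise[where f="\<lambda>i x. a' i + b' i * x"])
      (use s d in \<open>auto intro: prob_space_normal_density\<close>)
  moreover have "(\<lambda>x :: nat \<Rightarrow> real. \<lambda>i\<in>{..<n}. a' i + b' i * x i) = (\<lambda>x. \<lambda>i\<in>{..<n}. a i + b i * x i)"
    by (auto simp: fun_eq_iff a'_def b'_def)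
  ultimately show ?thesis by (simp add: gaussian_source_def)
qed

text \<open>Besides the signs 1 and -1, \<open>\<kappa>\<close> may take the value 0. A key with the
  zero pattern feeds the encoder the zero sequence, so that the message says nothing about the
  source, and \<open>masked_decoder\<close> then outputs the mean.\<close>

definition masked_source :: "real \<Rightarrow> real \<Rightarrow> nat \<Rightarrow> (nat \<Rightarrow> real) \<Rightarrow> (nat \<Rightarrow> real) \<Rightarrow> nat \<Rightarrow> real" where
  "masked_source \<mu> \<sigma> n \<kappa> x = (\<lambda>i\<in>{..<n}. \<kappa> i * ((x i - \<mu>) / \<sigma>))"

definition masked_encoder ::
    "real \<Rightarrow> real \<Rightarrow> real \<Rightarrow> nat \<Rightarrow> ((nat \<Rightarrow> real) \<Rightarrow> nat) \<Rightarrow> (nat \<Rightarrow> nat \<Rightarrow> real)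
      \<Rightarrow> (nat \<Rightarrow> real) \<times> nat \<Rightarrow> nat measure" where
  "masked_encoder \<mu> \<sigma> R n enc \<kappa> = (\<lambda>(x, k). return (count_space (rate_set R n)) (enc (masked_source \<mu> \<sigma> n (\<kappa> k) x)))"

definition masked_decoder ::
    "real \<Rightarrow> real \<Rightarrow> (nat \<Rightarrow> nat \<Rightarrow> real) \<Rightarrow> (nat \<Rightarrow> nat \<Rightarrow> real) \<Rightarrow> nat \<Rightarrow> nat \<times> nat \<Rightarrow> real measure" where
  "masked_decoder \<mu> \<sigma> c \<kappa> i = (\<lambda>(m, k). return borel (\<mu> + \<sigma> * \<kappa> k i * c m i))"

lemma masked_source_measurable: "masked_source \<mu> \<sigma> n \<kappa> \<in> seq_space n \<rightarrow>\<^sub>M seq_space n"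
  unfolding masked_source_def by measurable

lemma distr_masked_source:
  assumes "\<sigma> > 0" "\<And>i. i < n \<Longrightarrow> \<bar>\<kappa> i\<bar> = 1"
  shows "distr (gaussian_source \<mu> \<sigma> n) (gaussian_source 0 1 n) (masked_source \<mu> \<sigma> n \<kappa>) = gaussian_source 0 1 n"
proof -
  have "masked_source \<mu> \<sigma> n \<kappa> = (\<lambda>x. \<lambda>i\<in>{..<n}. - (\<kappa> i * \<mu> / \<sigma>) + \<kappa> i / \<sigma> * x i)"
    by (auto simp: masked_source_def fun_eq_iff diff_divide_distrib algebra_simps)
  moreover have "\<kappa> i \<noteq> 0" if "i < n" for i using assms(2)[OF that] by auto
  ultimately show ?thesis
    using assms by (simp only:) (rule distr_gaussian_source_affine, auto)
qed

lemma masked_encoder_in_encoders: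
  assumes enc: "enc \<in> seq_space n \<rightarrow>\<^sub>M count_space (rate_set R n)"
  shows "masked_encoder \<mu> \<sigma> R n enc \<kappa> \<in> encoders R Rs n"
proof -
  have k: "(\<lambda>p. \<kappa> (snd p) i) \<in> borel_measurable (seq_space n \<Otimes>\<^sub>M count_space (rate_set Rs n))" for i
    by (rule measurable_compose[OF measurable_snd]) simp
  have "(\<lambda>p. masked_source \<mu> \<sigma> n (\<kappa> (snd p)) (fst p)) \<in> seq_space n \<Otimes>\<^sub>M count_space (rate_set Rs n) \<rightarrow>\<^sub>M seq_space n"
    unfolding masked_source_def using k by measurable
  from measurable_compose[OF measurable_compose[OF this enc] measurable_return_prob_space]
  show ?thesis by (simp add: encoders_def masked_encoder_def split_beta')
qed

lemma masked_decoder_in_decoders: "masked_decoder \<mu> \<sigma> c \<kappa> \<in> decoders R Rs n"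
proof -
  have eq: "count_space (rate_set R n) \<Otimes>\<^sub>M count_space (rate_set Rs n)
      = count_space (rate_set R n \<times> rate_set Rs n)"
    by (intro pair_measure_countable countable_finite) simp_all
  show ?thesis
    unfolding decoders_def eq masked_decoder_def
    by (auto simp: space_prob_algebra intro: prob_space_return)
qed

text \<open>Reflecting \<open>x\<^sub>i\<close> about the mean has the same effect on the message as replacing the key
  \<open>k\<close> by \<open>\<tau> k\<close>, and it does not change the past. Hence the error at time \<open>i\<close> is the
  average of \<open>(z - x\<^sub>i)\<^sup>2\<close> and \<open>(z - (2 \<mu> - x\<^sub>i))\<^sup>2\<close>, which is at least \<open>(x\<^sub>i - \<mu>)\<^sup>2\<close>.\<close>

lemma eavesdropper_error_ge:
  assumes \<sigma>: "\<sigma> > 0" and Rs: "Rs \<ge> 0" and t: "t \<in> causal_eavesdroppers R n" and i: "i < n"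
    and enc: "enc \<in> seq_space n \<rightarrow>\<^sub>M count_space (rate_set R n)"
    and bij: "bij_betw \<tau> (rate_set Rs n) (rate_set Rs n)"
    and flip: "\<And>k j. k \<in> rate_set Rs n \<Longrightarrow> j < n \<Longrightarrow> \<kappa> (\<tau> k) j = (if j = i then - \<kappa> k j else \<kappa> k j)"
  shows "ennreal (\<sigma>\<^sup>2) \<le> (\<integral>\<^sup>+(x, y, z). ennreal ((z i - x i)\<^sup>2)
    \<partial>joint_law \<mu> \<sigma> Rs n (masked_encoder \<mu> \<sigma> R n enc \<kappa>) (masked_decoder \<mu> \<sigma> c \<kappa>) t)"
proof -
  let ?S = "seq_space n" and ?G = "gaussian_source \<mu> \<sigma> n" and ?A = "rate_set Rs n"
  define e where "e k x = enc (masked_source \<mu> \<sigma> n (\<kappa> k) x)" for k x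
  \<comment> \<open>The eavesdropper's error at time \<open>i\<close> with the target
    \<open>u\<close> separated from the source \<open>x\<close> that drives the law. The reflection
    can then move the target while the law stays fixed.\<close>
  define \<Psi> where "\<Psi> m x u = (\<integral>\<^sup>+z. ennreal ((z i - u)\<^sup>2) \<partial>eve_law t m x (Suc i))" for m x u
  define r where "r x = (\<lambda>j\<in>{..<n}. (if j = i then 2 * \<mu> else 0) + (if j = i then -1 else 1) * x j)"
    for x :: "nat \<Rightarrow> real"
  define I where "I = (\<integral>\<^sup>+(x, y, z). ennreal ((z i - x i)\<^sup>2)
    \<partial>joint_law \<mu> \<sigma> Rs n (masked_encoder \<mu> \<sigma> R n enc \<kappa>) (masked_decoder \<mu> \<sigma> c \<kappa>) t)"
  have card_pos: "card ?A > 0"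
    using rate_set_nonempty[OF Rs] by (simp add: card_gt_0_iff)
  have e [measurable]: "e k \<in> ?S \<rightarrow>\<^sub>M count_space (rate_set R n)" for k
    unfolding e_def by (rule measurable_compose[OF masked_source_measurable enc])
  have eR: "e k x \<in> rate_set R n" if "x \<in> space ?S" for k x
    using measurable_space[OF e that] by simp
  have kernel: "(\<lambda>x. eve_law t (e k x) x (Suc i)) \<in> ?S \<rightarrow>\<^sub>M subprob_algebra (seq_space (Suc i))" for k
    using measurable_compose[OF _ eve_law_measurable[OF t, of "Suc i"], of "\<lambda>x. (e k x, x)" ?S] i
    by (simp add: measurable_prob_algebraD)
  have err: "(\<lambda>z. ennreal ((z i - u)\<^sup>2)) \<in> borel_measurable (seq_space (Suc i))" for u
    by measurable
  have [measurable]: "(\<lambda>x. x i) \<in> borel_measurable ?S"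
    by (rule measurable_component_singleton) (use i in simp)
  have \<Psi>_meas [measurable]: "(\<lambda>x. \<Psi> (e k x) x (v x)) \<in> borel_measurable ?S"
    if [measurable]: "v \<in> borel_measurable ?S" for k v
    unfolding \<Psi>_def
    by (rule nn_integral_measurable_subprob_algebra2[OF _ kernel]) measurable
  have "I = (\<integral>\<^sup>+x. (\<Sum>k\<in>?A. \<integral>\<^sup>+m. \<Psi> m x (x i) \<partial>masked_encoder \<mu> \<sigma> R n enc \<kappa> (x, k))
      / ennreal (real (card ?A)) \<partial>?G)"
    unfolding I_def
  proof (rule nn_integral_joint_law_sum[OF \<sigma> Rs masked_encoder_in_encoders[OF enc] masked_decoder_in_decoders t])
    fix x k m assume *: "x \<in> space ?S" "k \<in> ?A" "m \<in> rate_set R n"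
    have "(\<integral>\<^sup>+z. ennreal ((z i - x i)\<^sup>2) \<partial>eve_law t m x n) = \<Psi> m x (x i)"
      unfolding \<Psi>_def using i by (intro nn_integral_eve_law_component[OF t *(3,1)]) auto
    then show "(\<integral>\<^sup>+y. \<integral>\<^sup>+z. (case (x, y, z) of (x, y, z) \<Rightarrow> ennreal ((z i - x i)\<^sup>2)) \<partial>eve_law t m x n
        \<partial>PiM {..<n} (\<lambda>i. masked_decoder \<mu> \<sigma> c \<kappa> i (m, k))) = \<Psi> m x (x i)"
      using decoder_space[OF masked_decoder_in_decoders *(3,2), of \<mu> \<sigma> c \<kappa>]
      by (simp add: space_prob_algebra prob_space.emeasure_space_1)
  qed measurable
  also have "\<dots> = (\<integral>\<^sup>+x. (\<Sum>k\<in>?A. \<Psi> (e k x) x (x i)) / ennreal (real (card ?A)) \<partial>?G)"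
    by (intro nn_integral_cong) (auto simp: masked_encoder_def e_def[symmetric] eR nn_integral_return)
  also have "\<dots> = (\<Sum>k\<in>?A. \<integral>\<^sup>+x. \<Psi> (e k x) x (x i) \<partial>?G) / ennreal (real (card ?A))"
    by (simp add: nn_integral_divide nn_integral_sum)
  finally have I1: "I = (\<Sum>k\<in>?A. \<integral>\<^sup>+x. \<Psi> (e k x) x (x i) \<partial>?G) / ennreal (real (card ?A))" .
  have rm: "r \<in> ?G \<rightarrow>\<^sub>M ?G"
    unfolding r_def by measurable
  have refl: "distr ?G ?G r = ?G"
    unfolding r_def by (rule distr_gaussian_source_affine) (use \<sigma> in auto)
  have "(\<integral>\<^sup>+x. \<Psi> (e k x) x (x i) \<partial>?G) = (\<integral>\<^sup>+x. \<Psi> (e (\<tau> k) x) x (2 * \<mu> - x i) \<partial>?G)" if k: "k \<in> ?A" for k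
  proof -
    have "(\<integral>\<^sup>+x. \<Psi> (e k x) x (x i) \<partial>?G) = (\<integral>\<^sup>+x. \<Psi> (e k (r x)) (r x) (r x i) \<partial>?G)"
      by (subst refl[symmetric], subst nn_integral_distr[OF rm]) auto
    also have "\<dots> = (\<integral>\<^sup>+x. \<Psi> (e (\<tau> k) x) x (2 * \<mu> - x i) \<partial>?G)"
    proof (rule nn_integral_cong)
      fix x assume "x \<in> space ?G"
      have "masked_source \<mu> \<sigma> n (\<kappa> k) (r x) = masked_source \<mu> \<sigma> n (\<kappa> (\<tau> k)) x"
        using \<sigma> by (auto simp: masked_source_def r_def flip[OF k] fun_eq_iff field_simps)
      then have "e k (r x) = e (\<tau> k) x" by (simp add: e_def)
      moreover have "restrict (r x) {..<i} = restrict x {..<i}"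
        using i by (auto simp: r_def fun_eq_iff restrict_def)
      \<comment> \<open>Here causality enters: \<open>r\<close> changes coordinate \<open>i\<close>
        only, and the law of the first \<open>Suc i\<close> reconstructions sees just the earlier
        ones.\<close>
      then have "\<Psi> m (r x) u = \<Psi> m x u" for m u
        unfolding \<Psi>_def by (simp only: eve_law_cong[of "r x" i x])
      moreover have "r x i = 2 * \<mu> - x i" using i by (simp add: r_def)
      ultimately show "\<Psi> (e k (r x)) (r x) (r x i) = \<Psi> (e (\<tau> k) x) x (2 * \<mu> - x i)" by simp
    qed
    finally show ?thesis .
  qed
  then have "(\<Sum>k\<in>?A. \<integral>\<^sup>+x. \<Psi> (e k x) x (x i) \<partial>?G)
      = (\<Sum>k\<in>?A. \<integral>\<^sup>+x. \<Psi> (e (\<tau> k) x) x (2 * \<mu> - x i) \<partial>?G)" by simp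
  \<comment> \<open>The key is uniform, so \<open>\<tau>\<close> merely permutes the terms. Thus
    \<open>I\<close> is also the error with respect to the reflected target, under the same messages
    as in \<open>I1\<close>.\<close>
  also have "\<dots> = (\<Sum>k\<in>?A. \<integral>\<^sup>+x. \<Psi> (e k x) x (2 * \<mu> - x i) \<partial>?G)"
    by (rule sum.reindex_bij_betw[OF bij])
  finally have I2: "I = (\<Sum>k\<in>?A. \<integral>\<^sup>+x. \<Psi> (e k x) x (2 * \<mu> - x i) \<partial>?G) / ennreal (real (card ?A))"
    using I1 by simp
  have lower: "2 * ennreal (\<sigma>\<^sup>2) \<le> (\<integral>\<^sup>+x. \<Psi> (e k x) x (x i) \<partial>?G) + (\<integral>\<^sup>+x. \<Psi> (e k x) x (2 * \<mu> - x i) \<partial>?G)" for k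
  proof -
    have "2 * ennreal (\<sigma>\<^sup>2) = (\<integral>\<^sup>+x. 2 * ennreal ((x i - \<mu>)\<^sup>2) \<partial>?G)"
      by (subst nn_integral_cmult) (auto simp: nn_integral_gaussian_source_square \<sigma> i)
    also have "\<dots> \<le> (\<integral>\<^sup>+x. \<Psi> (e k x) x (x i) + \<Psi> (e k x) x (2 * \<mu> - x i) \<partial>?G)"
    proof (rule nn_integral_mono)
      fix x assume "x \<in> space ?G"
      then have x: "x \<in> space ?S" by simp
      have E: "eve_law t (e k x) x (Suc i) \<in> space (prob_algebra (seq_space (Suc i)))"
        using i by (intro eve_law_space[OF t _ eR[OF x] x]) simp
      then have err': "(\<lambda>z. ennreal ((z i - u)\<^sup>2)) \<in> borel_measurable (eve_law t (e k x) x (Suc i))" for u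
        using err[of u] by (simp add: space_prob_algebra cong: measurable_cong_sets)
      have "2 * ennreal ((x i - \<mu>)\<^sup>2) = (\<integral>\<^sup>+z. 2 * ennreal ((x i - \<mu>)\<^sup>2) \<partial>eve_law t (e k x) x (Suc i))"
        using E by (simp only: space_prob_algebra nn_integral_const) (simp add: prob_space.emeasure_space_1)
      also have "\<dots> \<le> (\<integral>\<^sup>+z. ennreal ((z i - x i)\<^sup>2) + ennreal ((z i - (2 * \<mu> - x i))\<^sup>2)
          \<partial>eve_law t (e k x) x (Suc i))"
      proof (rule nn_integral_mono)
        fix z :: "nat \<Rightarrow> real"
        \<comment> \<open>The parallelogram identity; dropping the term in
          \<open>z i - \<mu>\<close> bounds every guess at once, and equality would require the
          guess \<open>\<mu>\<close>.\<close>
        have "(z i - x i)\<^sup>2 + (z i - (2 * \<mu> - x i))\<^sup>2 = 2 * (z i - \<mu>)\<^sup>2 + 2 * (x i - \<mu>)\<^sup>2"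
          by (simp add: power2_eq_square algebra_simps)
        then have "ennreal (2 * (x i - \<mu>)\<^sup>2) \<le> ennreal ((z i - x i)\<^sup>2 + (z i - (2 * \<mu> - x i))\<^sup>2)"
          by (intro ennreal_leI) simp
        then show "2 * ennreal ((x i - \<mu>)\<^sup>2) \<le> ennreal ((z i - x i)\<^sup>2) + ennreal ((z i - (2 * \<mu> - x i))\<^sup>2)"
          by (simp add: ennreal_mult)
      qed
      also have "\<dots> = \<Psi> (e k x) x (x i) + \<Psi> (e k x) x (2 * \<mu> - x i)"
        unfolding \<Psi>_def by (rule nn_integral_add[OF err' err'])
      finally show "2 * ennreal ((x i - \<mu>)\<^sup>2) \<le> \<Psi> (e k x) x (x i) + \<Psi> (e k x) x (2 * \<mu> - x i)" .
    qed
    also have "\<dots> = (\<integral>\<^sup>+x. \<Psi> (e k x) x (x i) \<partial>?G) + (\<integral>\<^sup>+x. \<Psi> (e k x) x (2 * \<mu> - x i) \<partial>?G)"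
      by (rule nn_integral_add) measurable
    finally show ?thesis .
  qed
  have "2 * ennreal (\<sigma>\<^sup>2) = (\<Sum>k\<in>?A. 2 * ennreal (\<sigma>\<^sup>2)) / ennreal (real (card ?A))"
    using card_pos rate_set_nonempty[OF Rs]
    by (simp add: ennreal_of_nat_eq_real_of_nat ennreal_mult[symmetric] divide_ennreal
        flip: ennreal_numeral)
  also have "\<dots> \<le> (\<Sum>k\<in>?A. (\<integral>\<^sup>+x. \<Psi> (e k x) x (x i) \<partial>?G) + (\<integral>\<^sup>+x. \<Psi> (e k x) x (2 * \<mu> - x i) \<partial>?G))
      / ennreal (real (card ?A))"
    by (intro divide_right_mono_ennreal sum_mono lower)
  also have "\<dots> = I + I"
    by (subst (1) I1, subst (1) I2) (simp add: sum.distrib add_divide_distrib_ennreal)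
  finally have "2 * ennreal (\<sigma>\<^sup>2) \<le> I + I" .
  then have "ennreal (\<sigma>\<^sup>2) \<le> I"
    by (cases I) (simp_all add: ennreal_mult[symmetric] ennreal_plus[symmetric] flip: ennreal_numeral del: ennreal_plus)
  then show ?thesis by (simp add: I_def)
qed

section \<open>The receiver's error, and the lower bound obtained from a code and a family of
  signs\<close>

text \<open>For a key in \<open>G\<close> the masked source is standard normal, and undoing the
  signs preserves distances up to the scale \<sigma>, so the error is that of the underlying code.
  Each remaining key leaves the receiver with the mean and the normalised error 1, which adds the
  fraction of such keys.\<close>

lemma masked_code_distortion:
  fixes \<kappa> :: "nat \<Rightarrow> nat \<Rightarrow> real"
  assumes \<sigma>: "\<sigma> > 0" and Rs: "Rs \<ge> 0" and n: "n > 0" and t: "t \<in> causal_eavesdroppers R n"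
    and enc: "enc \<in> seq_space n \<rightarrow>\<^sub>M count_space (rate_set R n)"
    and G: "G \<subseteq> rate_set Rs n"
    and sign: "\<And>k i. k \<in> G \<Longrightarrow> i < n \<Longrightarrow> \<bar>\<kappa> k i\<bar> = 1"
    and zero: "\<And>k i. k \<in> rate_set Rs n - G \<Longrightarrow> i < n \<Longrightarrow> \<kappa> k i = 0"
    and D: "(\<integral>\<^sup>+u. ennreal ((\<Sum>i<n. (c (enc u) i - u i)\<^sup>2) / n) \<partial>gaussian_source 0 1 n) \<le> ennreal D" "D \<ge> 0"
  shows "(\<integral>\<^sup>+(x, y, z). ennreal ((\<Sum>i<n. (y i - x i)\<^sup>2) / (\<sigma>\<^sup>2 * n))
    \<partial>joint_law \<mu> \<sigma> Rs n (masked_encoder \<mu> \<sigma> R n enc \<kappa>) (masked_decoder \<mu> \<sigma> c \<kappa>) t)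
    \<le> ennreal (D + card (rate_set Rs n - G) / card (rate_set Rs n))"
proof -
  let ?S = "seq_space n" and ?G = "gaussian_source \<mu> \<sigma> n" and ?A = "rate_set Rs n"
  define e where "e k x = enc (masked_source \<mu> \<sigma> n (\<kappa> k) x)" for k x
  have card_pos: "card ?A > 0"
    using rate_set_nonempty[OF Rs] by (simp add: card_gt_0_iff)
  have e [measurable]: "e k \<in> ?S \<rightarrow>\<^sub>M count_space (rate_set R n)" for k
    unfolding e_def by (rule measurable_compose[OF masked_source_measurable enc])
  have eR: "e k x \<in> rate_set R n" if "x \<in> space ?S" for k x
    using measurable_space[OF e that] by simp
  have [measurable]: "(\<lambda>x. c (e k x) i) \<in> borel_measurable ?S" for k i
    by (rule measurable_compose[OF e]) simp
  have [measurable]: "(\<lambda>x. c (enc x) i) \<in> borel_measurable ?S" for i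
    by (rule measurable_compose[OF enc]) simp
  define h where "h x y = ennreal ((\<Sum>i<n. (y i - x i)\<^sup>2) / (\<sigma>\<^sup>2 * n))" for x y :: "nat \<Rightarrow> real"
  define H where "H x k m = h x (\<lambda>i\<in>{..<n}. \<mu> + \<sigma> * \<kappa> k i * c m i)" for x k m
  have "(\<integral>\<^sup>+(x, y, z). ennreal ((\<Sum>i<n. (y i - x i)\<^sup>2) / (\<sigma>\<^sup>2 * n))
    \<partial>joint_law \<mu> \<sigma> Rs n (masked_encoder \<mu> \<sigma> R n enc \<kappa>) (masked_decoder \<mu> \<sigma> c \<kappa>) t)
    = (\<integral>\<^sup>+x. (\<Sum>k\<in>?A. \<integral>\<^sup>+m. H x k m \<partial>masked_encoder \<mu> \<sigma> R n enc \<kappa> (x, k))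
      / ennreal (real (card ?A)) \<partial>?G)"
  proof (rule nn_integral_joint_law_sum[OF \<sigma> Rs masked_encoder_in_encoders[OF enc] masked_decoder_in_decoders t])
    fix x k m assume *: "x \<in> space ?S" "k \<in> ?A" "m \<in> rate_set R n"
    have P: "PiM {..<n} (\<lambda>i. masked_decoder \<mu> \<sigma> c \<kappa> i (m, k))
        = return ?S (\<lambda>i\<in>{..<n}. \<mu> + \<sigma> * \<kappa> k i * c m i)"
      unfolding masked_decoder_def prod.case by (rule PiM_return) auto
    have [measurable]: "h x \<in> borel_measurable ?S" unfolding h_def by measurable
    show "(\<integral>\<^sup>+y. \<integral>\<^sup>+z. (case (x, y, z) of (x, y, z) \<Rightarrow> ennreal ((\<Sum>i<n. (y i - x i)\<^sup>2) / (\<sigma>\<^sup>2 * n)))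
        \<partial>eve_law t m x n \<partial>PiM {..<n} (\<lambda>i. masked_decoder \<mu> \<sigma> c \<kappa> i (m, k))) = H x k m"
      using eve_law_space[OF t order_refl *(3,1)]
      by (simp add: space_prob_algebra prob_space.emeasure_space_1 P h_def[symmetric] H_def
          nn_integral_return space_PiM)
  qed measurable
  also have "\<dots> = (\<integral>\<^sup>+x. (\<Sum>k\<in>?A. H x k (e k x)) / ennreal (real (card ?A)) \<partial>?G)"
    by (intro nn_integral_cong) (auto simp: masked_encoder_def e_def[symmetric] eR nn_integral_return)
  also have "\<dots> = (\<Sum>k\<in>?A. \<integral>\<^sup>+x. H x k (e k x) \<partial>?G) / ennreal (real (card ?A))"
    unfolding H_def h_def by (simp add: nn_integral_divide nn_integral_sum del: sum_ennreal)
  \<comment> \<open>For keys outside \<open>G\<close> the value is 1; it is weakened to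
    \<open>D + 1\<close> so that \<open>D\<close> can be pulled out of the average.\<close>
  also have "\<dots> \<le> (\<Sum>k\<in>?A. ennreal (D + (if k \<in> G then 0 else 1))) / ennreal (real (card ?A))"
  proof (intro divide_right_mono_ennreal sum_mono)
    fix k assume k: "k \<in> ?A"
    show "(\<integral>\<^sup>+x. H x k (e k x) \<partial>?G) \<le> ennreal (D + (if k \<in> G then 0 else 1))"
    proof (cases "k \<in> G")
      case True
      have [measurable]: "masked_source \<mu> \<sigma> n (\<kappa> k) \<in> ?G \<rightarrow>\<^sub>M gaussian_source 0 1 n"
        using masked_source_measurable by (simp cong: measurable_cong_sets)
      have "(\<integral>\<^sup>+x. H x k (e k x) \<partial>?G)
        = (\<integral>\<^sup>+x. (\<lambda>u. ennreal ((\<Sum>i<n. (c (enc u) i - u i)\<^sup>2) / n)) (masked_source \<mu> \<sigma> n (\<kappa> k) x) \<partial>?G)"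
      proof (rule nn_integral_cong)
        fix x :: "nat \<Rightarrow> real"
        have "(\<mu> + \<sigma> * \<kappa> k i * c m i - x i)\<^sup>2 / \<sigma>\<^sup>2 = (c m i - masked_source \<mu> \<sigma> n (\<kappa> k) x i)\<^sup>2" if "i < n" for i m
        proof -
          have "\<kappa> k i * \<kappa> k i = 1" using sign[OF True that] by (metis abs_mult_self_eq mult_1)
          then have "c m i - \<kappa> k i * ((x i - \<mu>) / \<sigma>) = \<kappa> k i * ((\<mu> + \<sigma> * \<kappa> k i * c m i - x i) / \<sigma>)"
            using \<sigma> by (simp add: field_simps)
          then have "(c m i - \<kappa> k i * ((x i - \<mu>) / \<sigma>))\<^sup>2 = (\<kappa> k i * \<kappa> k i) * ((\<mu> + \<sigma> * \<kappa> k i * c m i - x i)\<^sup>2 / \<sigma>\<^sup>2)"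
            by (simp add: power_mult_distrib power_divide power2_eq_square)
          then show ?thesis using \<open>\<kappa> k i * \<kappa> k i = 1\<close> that by (simp add: masked_source_def)
        qed
        then have "(\<Sum>i<n. ((\<mu> + \<sigma> * \<kappa> k i * c m i) - x i)\<^sup>2) / (\<sigma>\<^sup>2 * n)
            = (\<Sum>i<n. (c m i - masked_source \<mu> \<sigma> n (\<kappa> k) x i)\<^sup>2) / n" for m
          by (simp add: divide_divide_eq_left[symmetric] sum_divide_distrib)
        then show "H x k (e k x) = (\<lambda>u. ennreal ((\<Sum>i<n. (c (enc u) i - u i)\<^sup>2) / n)) (masked_source \<mu> \<sigma> n (\<kappa> k) x)"
          by (simp add: H_def h_def e_def)
      qed
      also have "\<dots> = (\<integral>\<^sup>+u. ennreal ((\<Sum>i<n. (c (enc u) i - u i)\<^sup>2) / n)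
          \<partial>distr ?G (gaussian_source 0 1 n) (masked_source \<mu> \<sigma> n (\<kappa> k)))"
        by (rule nn_integral_distr[symmetric]) measurable
      also have "\<dots> \<le> ennreal D"
        using D(1) by (subst distr_masked_source) (use \<sigma> sign True in auto)
      finally show ?thesis using True by simp
    next
      case False
      have "(\<integral>\<^sup>+x. H x k (e k x) \<partial>?G) = (\<integral>\<^sup>+x. (\<Sum>i<n. ennreal ((x i - \<mu>)\<^sup>2)) / ennreal (\<sigma>\<^sup>2 * n) \<partial>?G)"
        using zero[of k] k False \<sigma> n
        by (intro nn_integral_cong) (simp add: H_def h_def divide_ennreal sum_nonneg power2_commute)
      also have "\<dots> = (\<Sum>i<n. ennreal (\<sigma>\<^sup>2)) / ennreal (\<sigma>\<^sup>2 * n)"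
        by (simp add: nn_integral_divide nn_integral_sum nn_integral_gaussian_source_square \<sigma> del: sum_ennreal)
      also have "\<dots> = 1"
        using \<sigma> n by (simp add: ennreal_of_nat_eq_real_of_nat ennreal_mult[symmetric] divide_ennreal mult.commute)
      finally show ?thesis using False D(2) by simp
    qed
  qed
  also have "\<dots> = ennreal ((\<Sum>k\<in>?A. D + (if k \<in> G then 0 else 1)) / card ?A)"
    using D(2) card_pos by (subst sum_ennreal) (auto simp: divide_ennreal sum_nonneg)
  also have "(\<Sum>k\<in>?A. D + (if k \<in> G then 0 else 1)) = card ?A * D + card (?A - G)"
    by (simp add: sum.distrib sum.If_cases Diff_eq)
  also have "(card ?A * D + card (?A - G)) / card ?A = D + card (?A - G) / card ?A"
    using card_pos rate_set_nonempty[OF Rs] by (simp add: add_divide_distrib)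
  finally show ?thesis .
qed

lemma game_value_ge:
  fixes \<kappa> :: "nat \<Rightarrow> nat \<Rightarrow> real"
  assumes \<sigma>: "\<sigma> > 0" and Rs: "Rs \<ge> 0" and n: "n > 0"
    and enc: "enc \<in> seq_space n \<rightarrow>\<^sub>M count_space (rate_set R n)"
    and G: "G \<subseteq> rate_set Rs n"
    and sign: "\<And>k i. k \<in> G \<Longrightarrow> i < n \<Longrightarrow> \<bar>\<kappa> k i\<bar> = 1"
    and zero: "\<And>k i. k \<in> rate_set Rs n - G \<Longrightarrow> i < n \<Longrightarrow> \<kappa> k i = 0"
    and bij: "\<And>i. i < n \<Longrightarrow> bij_betw (\<tau> i) (rate_set Rs n) (rate_set Rs n)"
    and flip: "\<And>i j k. i < n \<Longrightarrow> j < n \<Longrightarrow> k \<in> rate_set Rs n \<Longrightarrow> \<kappa> (\<tau> i k) j = (if j = i then - \<kappa> k j else \<kappa> k j)"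
    and D: "(\<integral>\<^sup>+u. ennreal ((\<Sum>i<n. (c (enc u) i - u i)\<^sup>2) / n) \<partial>gaussian_source 0 1 n) \<le> ennreal D" "D \<ge> 0"
  shows "ereal (1 - (D + card (rate_set Rs n - G) / card (rate_set Rs n))) \<le> game_value \<mu> \<sigma> R Rs n"
proof -
  define f where "f = masked_encoder \<mu> \<sigma> R n enc \<kappa>"
  define g where "g = masked_decoder \<mu> \<sigma> c \<kappa>"
  define p where "p = D + card (rate_set Rs n - G) / card (rate_set Rs n)"
  have p: "p \<ge> 0" using D(2) by (simp add: p_def)
  have f: "f \<in> encoders R Rs n" unfolding f_def by (rule masked_encoder_in_encoders[OF enc])
  have g: "g \<in> decoders R Rs n" unfolding g_def by (rule masked_decoder_in_decoders)
  have "ereal (1 - p) \<le> (INF t\<in>causal_eavesdroppers R n.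
      ext_expectation (joint_law \<mu> \<sigma> Rs n f g t) (block_payoff \<sigma> n))"
  proof (rule INF_greatest)
    fix t assume t: "t \<in> causal_eavesdroppers R n"
    define J where "J = joint_law \<mu> \<sigma> Rs n f g t"
    have sJ: "sets J = sets (seq_space n \<Otimes>\<^sub>M seq_space n \<Otimes>\<^sub>M seq_space n)"
      unfolding J_def using nn_integral_joint_law(2)[OF \<sigma> Rs f g t, of "\<lambda>_. 0"] by auto
    define A where "A = (\<integral>\<^sup>+(x, y, z). ennreal ((\<Sum>i<n. (z i - x i)\<^sup>2) / (\<sigma>\<^sup>2 * n)) \<partial>J)"
    define B where "B = (\<integral>\<^sup>+(x, y, z). ennreal ((\<Sum>i<n. (y i - x i)\<^sup>2) / (\<sigma>\<^sup>2 * n)) \<partial>J)"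
    have B: "B \<le> ennreal p"
      unfolding B_def J_def f_def g_def p_def
      by (rule masked_code_distortion[OF \<sigma> Rs n t enc G sign zero D])
    have "1 = (\<Sum>i<n. ennreal (\<sigma>\<^sup>2)) / ennreal (\<sigma>\<^sup>2 * n)"
      using \<sigma> n by (simp add: ennreal_of_nat_eq_real_of_nat ennreal_mult[symmetric] divide_ennreal mult.commute)
    also have "\<dots> \<le> A"
      unfolding A_def nn_integral_block_error[OF \<sigma> sJ]
      unfolding J_def f_def g_def
    proof (intro divide_right_mono_ennreal sum_mono)
      fix i assume "i \<in> {..<n}"
      then have i: "i < n" by simp
      show "ennreal (\<sigma>\<^sup>2) \<le> (\<integral>\<^sup>+(x, y, z). ennreal ((z i - x i)\<^sup>2) \<partial>joint_law \<mu> \<sigma> Rs n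
          (masked_encoder \<mu> \<sigma> R n enc \<kappa>) (masked_decoder \<mu> \<sigma> c \<kappa>) t)"
        by (rule eavesdropper_error_ge[OF \<sigma> Rs t i enc bij[OF i]]) (rule flip[OF i])
    qed
    finally have A: "1 \<le> A" .
    \<comment> \<open>Finiteness comes from the receiver's side, through \<open>B\<close>. The
      eavesdropper's error \<open>A\<close> may be infinite, and then the payoff is infinite as
      well.\<close>
    have "ext_expectation J (block_payoff \<sigma> n) = enn2ereal A - enn2ereal B"
      unfolding J_def A_def B_def
      by (intro ext_expectation_block_payoff[OF \<sigma> Rs f g t])
        (use B in \<open>auto simp: J_def B_def less_top[symmetric] top_unique\<close>)
    moreover obtain b where "B = ennreal b" "b \<ge> 0" "b \<le> p"
      using B p by (cases B) (auto simp: top_unique)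
    ultimately show "ereal (1 - p) \<le> ext_expectation J (block_payoff \<sigma> n)"
      using A by (cases A) (auto simp: enn2ereal_ennreal one_ereal_def)
  qed
  also have "\<dots> \<le> game_value \<mu> \<sigma> R Rs n"
    unfolding game_value_def using f g by (intro SUP_upper2[of "(f, g)"]) auto
  finally show ?thesis by (simp add: p_def)
qed

section \<open>Covering by Gaussian codewords\<close>

text \<open>Bayes' rule for the test channel \<open>x = c + noise\<close> with \<open>c \<sim> N(0, 1 - \<delta>)\<close> and noise
  variance \<open>\<delta>\<close>: the left-hand side is the posterior of \<open>c\<close> given \<open>x\<close>.\<close>

lemma gauss_posterior:
  assumes \<delta>: "0 < \<delta>" "\<delta> < 1"
  shows "gauss ((1 - \<delta>) * x) (sqrt (\<delta> * (1 - \<delta>)))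
    = density (gauss 0 (sqrt (1 - \<delta>))) (\<lambda>c. exp (ln (1 / \<delta>) / 2 - (x - c)\<^sup>2 / (2 * \<delta>) + x\<^sup>2 / 2))"
proof -
  define s where "s = 1 - \<delta>"
  have s: "s > 0" "\<delta> = 1 - s" using \<delta> by (auto simp: s_def)
  have "normal_density (s * x) (sqrt (\<delta> * s)) c
    = normal_density 0 (sqrt s) c * exp (ln (1 / \<delta>) / 2 - (x - c)\<^sup>2 / (2 * \<delta>) + x\<^sup>2 / 2)" for c
  proof -
    \<comment> \<open>Completing the square in \<open>c\<close>, using that the variances \<delta>
      and \<open>s\<close> add up to 1.\<close>
    have "\<delta> * c\<^sup>2 + s * (x - c)\<^sup>2 - \<delta> * s * x\<^sup>2 = (c - s * x)\<^sup>2"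
      unfolding s(2) by (simp add: power2_eq_square algebra_simps)
    then have "- (c - s * x)\<^sup>2 / (2 * (\<delta> * s)) = - (\<delta> * c\<^sup>2 + s * (x - c)\<^sup>2 - \<delta> * s * x\<^sup>2) / (2 * (\<delta> * s))"
      by simp
    also have "\<dots> = - c\<^sup>2 / (2 * s) + (- (x - c)\<^sup>2 / (2 * \<delta>) + x\<^sup>2 / 2)"
      using \<delta>(1) s(1) by (simp add: field_simps)
    finally have e: "exp (- (c - s * x)\<^sup>2 / (2 * (\<delta> * s)))
        = exp (- c\<^sup>2 / (2 * s)) * exp (- (x - c)\<^sup>2 / (2 * \<delta>) + x\<^sup>2 / 2)"
      by (simp only: exp_add)
    have "exp (ln (1 / \<delta>) / 2) = sqrt (1 / \<delta>)"
      using \<delta>(1) by (simp add: powr_half_sqrt[symmetric] powr_def)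
    then have "1 / sqrt (2 * pi * (\<delta> * s)) = 1 / sqrt (2 * pi * s) * exp (ln (1 / \<delta>) / 2)"
      by (simp add: real_sqrt_mult real_sqrt_divide)
    moreover have "exp (ln (1 / \<delta>) / 2 - (x - c)\<^sup>2 / (2 * \<delta>) + x\<^sup>2 / 2)
        = exp (ln (1 / \<delta>) / 2) * exp (- (x - c)\<^sup>2 / (2 * \<delta>) + x\<^sup>2 / 2)"
      by (simp add: exp_add[symmetric])
    ultimately show ?thesis
      using \<delta>(1) s(1) e by (simp add: normal_density_def)
  qed
  then show ?thesis
    by (simp add: s_def[symmetric] density_density_eq ennreal_mult normal_density_nonneg)
qed

text \<open>Change of measure. A codeword drawn from the posterior \<open>Q\<close> given
  \<open>x\<close> lies in the event \<open>E\<close>, hence close to \<open>x\<close>, with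
  probability at least 1/2. On \<open>E\<close> the likelihood ratio of \<open>Q\<close> against the
  codeword law \<open>N\<close> is at most \<open>exp \<gamma>\<close>, so \<open>N\<close> gives
  \<open>E\<close> at least \<open>exp (- \<gamma>) / 2\<close>.\<close>

lemma gauss_ball_ge:
  fixes x :: "nat \<Rightarrow> real"
  assumes \<delta>: "0 < \<delta>" "\<delta> < 1" and \<eta>: "0 < \<eta>" "\<eta> \<le> 1" and n: "4 \<le> real n * \<eta>\<^sup>2"
    and x: "(\<Sum>i<n. (x i)\<^sup>2) \<le> n * (1 + \<eta>)"
  shows "exp (- (n * (ln (1 / \<delta>) / 2 + 2 * \<eta> / \<delta>))) / 2
    \<le> measure (gaussian_source 0 (sqrt (1 - \<delta>)) n)
        {c \<in> space (seq_space n). (\<Sum>i<n. (c i - x i)\<^sup>2) \<le> n * (\<delta> + 4 * \<eta>)}"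
proof -
  define v where "v = \<delta> * (1 - \<delta>)"
  define m where "m i = (1 - \<delta>) * x i" for i
  define N where "N = gaussian_source 0 (sqrt (1 - \<delta>)) n"
  define Q where "Q = PiM {..<n} (\<lambda>i. gauss (m i) (sqrt v))"
  define \<rho> where "\<rho> i c = exp (ln (1 / \<delta>) / 2 - (x i - c)\<^sup>2 / (2 * \<delta>) + (x i)\<^sup>2 / 2)" for i c
  define \<gamma> where "\<gamma> = n * (ln (1 / \<delta>) / 2 + 2 * \<eta> / \<delta>)"
  \<comment> \<open>The two fluctuations that matter. Since \<open>c i - x i\<close> equals
    \<open>(c i - m i) - \<delta> * x i\<close>, the squared distance is determined by the energy of
    \<open>x\<close>, the correlation \<open>T1\<close> of \<open>x\<close> with the posterior
    noise, and the centred noise energy \<open>T2\<close>.\<close>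
  define T1 where "T1 c = (\<Sum>i<n. x i * (c i - m i))" for c
  define T2 where "T2 c = (\<Sum>i<n. (c i - m i)\<^sup>2 - v)" for c
  define E where "E = {c \<in> space (seq_space n). \<bar>T1 c\<bar> < n * \<eta> \<and> \<bar>T2 c\<bar> < n * \<eta>}"
  have n0: "real n > 0" using n by (cases "n = 0") auto
  have v: "0 < v" "v \<le> 1" "v\<^sup>2 \<le> v"
    using \<delta> by (auto simp: v_def power2_eq_square mult_le_one intro: mult_left_le)
  have v4: "v \<le> 1 / 4"
    using sum_squares_bound[of "\<delta> - 1/2" 0] by (simp add: v_def power2_eq_square algebra_simps)
  have sv: "sqrt v > 0" "(sqrt v)\<^sup>2 = v" "sqrt v ^ 4 = v\<^sup>2"
    using v by (auto simp: power4_eq_xxxx power2_eq_square)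
  have prob: "prob_space (gauss (m i) (sqrt v))" for i
    by (rule prob_space_normal_density[OF sv(1)])
  interpret N: prob_space N
    unfolding N_def by (rule prob_space_gaussian_source) (use \<delta> in simp)
  interpret Q: prob_space Q
    unfolding Q_def by (rule prob_space_PiM) (rule prob)
  have sN [measurable_cong]: "sets N = sets (seq_space n)" by (simp add: N_def)
  have sQ [measurable_cong]: "sets Q = sets (seq_space n)"
    unfolding Q_def by (intro sets_PiM_cong) auto
  have spQ: "space Q = space (seq_space n)" by (rule sets_eq_imp_space_eq[OF sQ])
  have Q_density: "Q = density N (\<lambda>c. \<Prod>i<n. ennreal (\<rho> i (c i)))"
  proof -
    have "Q = PiM {..<n} (\<lambda>i. density (gauss 0 (sqrt (1 - \<delta>))) (\<lambda>c. ennreal (\<rho> i c)))"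
      unfolding Q_def m_def v_def \<rho>_def by (simp only: gauss_posterior[OF \<delta>])
    also have "\<dots> = density N (\<lambda>c. \<Prod>i<n. ennreal (\<rho> i (c i)))"
      unfolding N_def gaussian_source_def
    proof (rule PiM_density)
      show "sigma_finite_measure (gauss 0 (sqrt (1 - \<delta>)))" for i :: nat
        using prob_space_normal_density[of "sqrt (1 - \<delta>)" 0] \<delta>
        by (intro prob_space_imp_sigma_finite) simp
      show "sigma_finite_measure (density (gauss 0 (sqrt (1 - \<delta>))) (\<lambda>c. ennreal (\<rho> i c)))" for i
        using prob[of i] unfolding \<rho>_def m_def v_def gauss_posterior[OF \<delta>]
        by (rule prob_space_imp_sigma_finite)
    qed (auto simp: \<rho>_def)
    finally show ?thesis .
  qed
  have T [measurable]: "T1 \<in> borel_measurable (seq_space n)" "T2 \<in> borel_measurable (seq_space n)"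
    unfolding T1_def T2_def by measurable
  have E [measurable]: "E \<in> sets (seq_space n)"
    unfolding E_def by measurable
  \<comment> \<open>The hypothesis on \<open>n\<close> makes each of the two Chebyshev bounds at
    most 1/4, which leaves probability 1/2 for \<open>E\<close>.\<close>
  have bound: "0 < real n * \<eta>" "(real n * \<eta>)\<^sup>2 \<ge> 4 * real n"
    using n0 \<eta>(1) n mult_left_mono[OF n, of "real n"]
    by (auto simp: power2_eq_square algebra_simps)
  have "measure Q {c \<in> space Q. n * \<eta> \<le> \<bar>T1 c\<bar>}
      \<le> (\<Sum>i<n. \<integral>c. (x i * (c - m i))\<^sup>2 \<partial>gauss (m i) (sqrt v)) / (n * \<eta>)\<^sup>2"
    unfolding Q_def T1_def
    by (rule prob_sum_PiM_ge)
      (use prob gauss_moment_1[OF sv(1)] gauss_moment_2[OF sv(1)] bound(1)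
        in \<open>auto simp: has_bochner_integral_iff power_mult_distrib\<close>)
  also have "\<dots> = v * (\<Sum>i<n. (x i)\<^sup>2) / (n * \<eta>)\<^sup>2"
    using gauss_moment_2[OF sv(1)]
    by (simp add: has_bochner_integral_iff power_mult_distrib sv sum_distrib_left mult.commute)
  also have "\<dots> \<le> v * (n * (1 + \<eta>)) / (n * \<eta>)\<^sup>2"
    using x v by (intro divide_right_mono mult_left_mono) auto
  also have "\<dots> \<le> n / (n * \<eta>)\<^sup>2"
  proof (rule divide_right_mono)
    have "v * (1 + \<eta>) \<le> 1 / 4 * 2" using v v4 \<eta> by (intro mult_mono) auto
    then have "v * (1 + \<eta>) \<le> 1" by simp
    then show "v * (n * (1 + \<eta>)) \<le> n"
      using mult_left_mono[of "v * (1 + \<eta>)" 1 "real n"] n0 by (simp add: mult_ac)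
  qed simp
  also have "\<dots> \<le> 1 / 4"
    using bound n0 by (simp add: divide_le_eq)
  finally have Q1: "measure Q {c \<in> space Q. n * \<eta> \<le> \<bar>T1 c\<bar>} \<le> 1 / 4" .
  have "measure Q {c \<in> space Q. n * \<eta> \<le> \<bar>T2 c\<bar>}
      \<le> (\<Sum>i<n. \<integral>c. ((c - m i)\<^sup>2 - v)\<^sup>2 \<partial>gauss (m i) (sqrt v)) / (n * \<eta>)\<^sup>2"
    unfolding Q_def T2_def
    by (rule prob_sum_PiM_ge)
      (use prob gauss_variance_of_square[OF sv(1)] bound(1) in \<open>auto simp: has_bochner_integral_iff sv\<close>)
  also have "\<dots> = n * (2 * v\<^sup>2) / (n * \<eta>)\<^sup>2"
    using gauss_variance_of_square(2)[OF sv(1)] by (simp add: has_bochner_integral_iff sv)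
  also have "\<dots> \<le> real n * 1 / (n * \<eta>)\<^sup>2"
  proof (intro divide_right_mono mult_left_mono)
    show "2 * v\<^sup>2 \<le> 1" using v v4 by linarith
  qed auto
  also have "\<dots> \<le> 1 / 4"
    using bound n0 by (simp add: divide_le_eq)
  finally have Q2: "measure Q {c \<in> space Q. n * \<eta> \<le> \<bar>T2 c\<bar>} \<le> 1 / 4" .
  have "1 - measure Q E = measure Q (space Q - E)"
    using E sQ by (subst Q.prob_compl) auto
  also have "\<dots> \<le> measure Q ({c \<in> space Q. n * \<eta> \<le> \<bar>T1 c\<bar>} \<union> {c \<in> space Q. n * \<eta> \<le> \<bar>T2 c\<bar>})"
    by (intro Q.finite_measure_mono) (auto simp: E_def spQ not_less)
  also have "\<dots> \<le> 1 / 4 + 1 / 4"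
    by (intro order.trans[OF measure_Un_le] add_mono Q1 Q2) measurable
  finally have QE: "1 / 2 \<le> measure Q E" by simp
  have on_E: "(\<Sum>i<n. (c i - x i)\<^sup>2) \<le> n * (\<delta> + 4 * \<eta>)"
    "(\<Sum>i<n. ln (1 / \<delta>) / 2 - (x i - c i)\<^sup>2 / (2 * \<delta>) + (x i)\<^sup>2 / 2) \<le> \<gamma>" if "c \<in> E" for c
  proof -
    define X where "X = (\<Sum>i<n. (x i)\<^sup>2)"
    define D where "D = (\<Sum>i<n. (c i - x i)\<^sup>2)"
    have X: "X \<le> n * (1 + \<eta>)" using x by (simp add: X_def)
    have "(c i - x i)\<^sup>2 = \<delta>\<^sup>2 * (x i)\<^sup>2 - 2 * \<delta> * (x i * (c i - m i)) + ((c i - m i)\<^sup>2 - v) + v" for i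
      by (simp add: m_def power2_eq_square algebra_simps)
    then have D: "D = \<delta>\<^sup>2 * X - 2 * \<delta> * T1 c + T2 c + n * v"
      by (simp add: D_def X_def T1_def T2_def sum.distrib sum_subtractf sum_distrib_left)
    have T1: "\<bar>T1 c\<bar> < n * \<eta>" and T2: "\<bar>T2 c\<bar> < n * \<eta>"
      using that by (auto simp: E_def)
    have dT: "\<bar>2 * \<delta> * T1 c\<bar> \<le> 2 * \<delta> * (n * \<eta>)"
      using T1 \<delta> by (simp add: abs_mult)
    have d1: "\<delta>\<^sup>2 \<le> 1" using \<delta> by (simp add: power_le_one)
    have "D \<le> \<delta>\<^sup>2 * (n * (1 + \<eta>)) + 2 * \<delta> * (n * \<eta>) + n * \<eta> + n * v"
      using D dT T2 mult_left_mono[OF X zero_le_power2[of \<delta>]] by linarith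
    \<comment> \<open>The main terms add up to \<open>\<delta>\<^sup>2 + v = \<delta>\<close>. The
      error terms form (1 + \<delta>)^2 * \<eta>, at most 4 * \<eta>, which explains the
      radius.\<close>
    also have "\<dots> = n * (\<delta> + (\<delta>\<^sup>2 + 2 * \<delta> + 1) * \<eta>)"
      by (simp add: v_def power2_eq_square algebra_simps)
    also have "\<dots> \<le> n * (\<delta> + 4 * \<eta>)"
      using d1 \<delta> \<eta> n0 by (intro mult_left_mono add_left_mono mult_right_mono) auto
    finally show "(\<Sum>i<n. (c i - x i)\<^sup>2) \<le> n * (\<delta> + 4 * \<eta>)" by (simp add: D_def)
    have "\<delta> * X - D = \<delta> * (1 - \<delta>) * X + 2 * \<delta> * T1 c - T2 c - n * v"
      by (simp add: D power2_eq_square algebra_simps)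
    also have "\<dots> \<le> v * (n * (1 + \<eta>)) + 2 * \<delta> * (n * \<eta>) + n * \<eta> - n * v"
      using dT T2 mult_left_mono[OF X less_imp_le[OF v(1)]] unfolding v_def[symmetric] by linarith
    \<comment> \<open>The terms without \<eta> cancel. The rest is at most 4 * n * \<eta>, and
      division by 2 * \<delta> gives the summand \<open>2 * \<eta> / \<delta>\<close> of the
      exponent.\<close>
    also have "\<dots> = n * \<eta> * (v + 2 * \<delta> + 1)"
      by (simp add: algebra_simps)
    also have "\<dots> \<le> n * \<eta> * 4"
      using v4 \<delta> bound(1) by (intro mult_left_mono) auto
    finally have "(\<delta> * X - D) / (2 * \<delta>) \<le> n * \<eta> * 4 / (2 * \<delta>)"
      using \<delta> by (intro divide_right_mono) auto
    moreover have "(\<Sum>i<n. ln (1 / \<delta>) / 2 - (x i - c i)\<^sup>2 / (2 * \<delta>) + (x i)\<^sup>2 / 2)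
        = n * (ln (1 / \<delta>) / 2) + (\<delta> * X - D) / (2 * \<delta>)"
      using \<delta> by (simp add: sum.distrib sum_subtractf sum_divide_distrib[symmetric] D_def X_def
          power2_commute diff_divide_distrib)
    ultimately show "(\<Sum>i<n. ln (1 / \<delta>) / 2 - (x i - c i)\<^sup>2 / (2 * \<delta>) + (x i)\<^sup>2 / 2) \<le> \<gamma>"
      by (simp add: \<gamma>_def algebra_simps)
  qed
  have "emeasure Q E = (\<integral>\<^sup>+c. (\<Prod>i<n. ennreal (\<rho> i (c i))) * indicator E c \<partial>N)"
    unfolding Q_density by (rule emeasure_density) (auto simp: \<rho>_def sN)
  also have "\<dots> \<le> (\<integral>\<^sup>+c. ennreal (exp \<gamma>) * indicator E c \<partial>N)"
  proof (intro nn_integral_mono)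
    fix c
    have "(\<Prod>i<n. ennreal (\<rho> i (c i))) \<le> ennreal (exp \<gamma>)" if "c \<in> E"
      using on_E(2)[OF that] by (simp add: \<rho>_def prod_ennreal exp_sum[symmetric])
    then show "(\<Prod>i<n. ennreal (\<rho> i (c i))) * indicator E c \<le> ennreal (exp \<gamma>) * indicator E c"
      by (auto simp: indicator_def)
  qed
  also have "\<dots> = ennreal (exp \<gamma> * measure N E)"
    by (subst nn_integral_cmult_indicator) (auto simp: sN N.emeasure_eq_measure ennreal_mult)
  finally have "measure Q E \<le> exp \<gamma> * measure N E"
    by (simp add: Q.emeasure_eq_measure)
  then have "exp (- \<gamma>) * (1 / 2) \<le> exp (- \<gamma>) * (exp \<gamma> * measure N E)"
    using QE by (intro mult_left_mono) auto
  also have "\<dots> = measure N E"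
    by (simp add: exp_minus)
  also have "\<dots> \<le> measure N {c \<in> space (seq_space n). (\<Sum>i<n. (c i - x i)\<^sup>2) \<le> n * (\<delta> + 4 * \<eta>)}"
    by (rule N.finite_measure_mono) (auto simp: sN on_E(1) E_def intro!: on_E(1)[unfolded E_def])
  finally show ?thesis by (simp add: \<gamma>_def N_def)
qed

section \<open>Choosing the codewords one by one\<close>

lemma (in prob_space) exists_le_nn_integral:
  assumes [measurable]: "\<phi> \<in> borel_measurable M" and le: "(\<integral>\<^sup>+c. \<phi> c \<partial>M) \<le> k" and k: "k < \<infinity>"
  shows "\<exists>c\<in>space M. \<phi> c \<le> k"
proof (rule ccontr)
  assume "\<not> ?thesis"
  then have gt: "\<And>c. c \<in> space M \<Longrightarrow> k < \<phi> c" by (auto simp: not_le)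
  have "(\<integral>\<^sup>+c. k \<partial>M) < (\<integral>\<^sup>+c. \<phi> c \<partial>M)"
  proof (rule nn_integral_less)
    show "(\<integral>\<^sup>+c. k \<partial>M) \<noteq> \<infinity>" using k by (simp add: emeasure_space_1 less_top[symmetric])
    show "AE c in M. k \<le> \<phi> c" using gt by (auto intro!: AE_I2 less_imp_le)
    show "\<not> (AE c in M. \<phi> c \<le> k)"
    proof
      assume "AE c in M. \<phi> c \<le> k"
      with AE_space have "AE c in M. False" by eventually_elim (use gt in \<open>auto simp: not_le[symmetric]\<close>)
      then show False by simp
    qed
  qed simp_all
  with le show False by (simp add: emeasure_space_1)
qed

text \<open>Random coding, derandomised greedily: each new codeword covers at least the fraction \<open>p\<close>
  of what is still uncovered.\<close>

lemma greedy_cover: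
  assumes P: "prob_space P" and N: "prob_space N" and S: "S \<in> sets (P \<Otimes>\<^sub>M N)" and T: "T \<in> sets P"
    and p: "0 \<le> p" "p \<le> 1" "\<And>x. x \<in> T \<Longrightarrow> p \<le> measure N {c \<in> space N. (x, c) \<in> S}"
  shows "\<exists>c. (\<forall>j. c j \<in> space N) \<and> measure P {x \<in> T. \<forall>j<J. (x, c j) \<notin> S} \<le> (1 - p) ^ J"
proof -
  interpret P: prob_space P by (rule P)
  interpret N: prob_space N by (rule N)
  interpret PN: pair_prob_space P N ..
  note S [measurable] and T [measurable]
  have pair [measurable]: "(\<lambda>x. (x, c)) \<in> P \<rightarrow>\<^sub>M P \<Otimes>\<^sub>M N" if "c \<in> space N" for c
    using that by measurable
  have step: "\<exists>c\<in>space N. measure P {x \<in> U. (x, c) \<notin> S} \<le> (1 - p) * measure P U"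
    if U [measurable]: "U \<in> sets P" and UT: "U \<subseteq> T" for U
  proof -
    \<comment> \<open>Pairs of a point of \<open>U\<close> and a codeword that misses it. Its
      sections at \<open>x\<close> have measure at most \<open>1 - p\<close>; Fubini bounds the mean
      of its sections at \<open>c\<close>, and some \<open>c\<close> does no worse than the
      mean.\<close>
    define X where "X = U \<times> space N - S"
    have X [measurable]: "X \<in> sets (P \<Otimes>\<^sub>M N)" unfolding X_def by measurable
    have sec: "(\<lambda>x. (x, c)) -` X = {x \<in> U. (x, c) \<notin> S}" if "c \<in> space N" for c
      using that by (auto simp: X_def)
    have "(\<integral>\<^sup>+c. emeasure P ((\<lambda>x. (x, c)) -` X) \<partial>N) = emeasure (P \<Otimes>\<^sub>M N) X"
      by (rule PN.emeasure_pair_measure_alt2[OF X, symmetric])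
    also have "\<dots> = (\<integral>\<^sup>+x. emeasure N (Pair x -` X) \<partial>P)"
      by (rule N.emeasure_pair_measure_alt[OF X])
    also have "\<dots> \<le> (\<integral>\<^sup>+x. ennreal (1 - p) * indicator U x \<partial>P)"
    proof (rule nn_integral_mono)
      fix x assume x: "x \<in> space P"
      show "emeasure N (Pair x -` X) \<le> ennreal (1 - p) * indicator U x"
      proof (cases "x \<in> U")
        case True
        have m: "{c \<in> space N. (x, c) \<in> S} \<in> sets N"
          using measurable_sets[OF measurable_Pair1'[OF x] S] by (simp add: vimage_def Int_def conj_commute)
        have "Pair x -` X = space N - {c \<in> space N. (x, c) \<in> S}"
          using True by (auto simp: X_def)
        then have "measure N (Pair x -` X) = 1 - measure N {c \<in> space N. (x, c) \<in> S}"
          using N.prob_compl[OF m] by simp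
        also have "\<dots> \<le> 1 - p" using p(3)[of x] True UT by auto
        finally show ?thesis
          using True by (simp add: N.emeasure_eq_measure ennreal_leI)
      next
        case False
        then have "Pair x -` X = {}" by (auto simp: X_def)
        then show ?thesis by simp
      qed
    qed
    also have "\<dots> = ennreal ((1 - p) * measure P U)"
      using p by (simp add: nn_integral_cmult_indicator P.emeasure_eq_measure ennreal_mult)
    finally have "(\<integral>\<^sup>+c. emeasure P ((\<lambda>x. (x, c)) -` X) \<partial>N) \<le> ennreal ((1 - p) * measure P U)" .
    from N.exists_le_nn_integral[OF PN.measurable_emeasure_Pair2[OF X] this]
    obtain c where "c \<in> space N" "emeasure P ((\<lambda>x. (x, c)) -` X) \<le> ennreal ((1 - p) * measure P U)"
      by auto
    then show ?thesis
      using p by (auto simp: sec P.emeasure_eq_measure intro!: bexI[of _ c])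
  qed
  show ?thesis
  proof (induction J)
    case 0
    obtain c0 where "c0 \<in> space N" using N.not_empty by auto
    then show ?case by (intro exI[of _ "\<lambda>_. c0"]) (simp add: P.prob_le_1)
  next
    case (Suc J)
    then obtain c where c: "\<And>j. c j \<in> space N"
      and le: "measure P {x \<in> T. \<forall>j<J. (x, c j) \<notin> S} \<le> (1 - p) ^ J" by auto
    define U where "U = {x \<in> T. \<forall>j<J. (x, c j) \<notin> S}"
    have "U = T - (\<Union>j<J. (\<lambda>x. (x, c j)) -` S \<inter> space P)"
      using sets.sets_into_space[OF T] by (auto simp: U_def)
    then have U: "U \<in> sets P"
      using measurable_sets[OF pair[OF c] S] T by (simp only:) (intro sets.Diff sets.finite_UN, auto)
    obtain c' where c': "c' \<in> space N" "measure P {x \<in> U. (x, c') \<notin> S} \<le> (1 - p) * measure P U"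
      using step[OF U] by (auto simp: U_def)
    have "{x \<in> T. \<forall>j<Suc J. (x, (c(J := c')) j) \<notin> S} = {x \<in> U. (x, c') \<notin> S}"
      by (auto simp: U_def less_Suc_eq)
    then have "measure P {x \<in> T. \<forall>j<Suc J. (x, (c(J := c')) j) \<notin> S} \<le> (1 - p) * measure P U"
      using c'(2) by simp
    also have "\<dots> \<le> (1 - p) * (1 - p) ^ J"
      using le p by (intro mult_left_mono) (auto simp: U_def)
    finally show ?case
      using c c'(1) by (intro exI[of _ "c(J := c')"]) auto
  qed
qed

section \<open>Rate-distortion codes and key signs\<close>

lemma card_rate_set_gt: "2 powr (real n * R) - 1 < real (card (rate_set R n))"
proof -
  have "real_of_int \<lfloor>2 powr (real n * R)\<rfloor> \<le> real (card (rate_set R n))"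
    by (simp add: rate_set_def)
  then show ?thesis by linarith
qed

text \<open>Three contributions: the radius \<open>\<delta> + 4 * \<eta>\<close> for covered
  sequences, 2 times the probability that a sequence of moderate energy stays uncovered, and
  \<open>4 / (n * \<eta>\<^sup>2)\<close> for sequences of large energy. One message is kept as a
  fallback, hence the exponent with \<open>- 1\<close>.\<close>

lemma rate_distortion_code:
  fixes R \<delta> \<eta> :: real and n :: nat
  defines "p \<equiv> exp (- (n * (ln (1 / \<delta>) / 2 + 2 * \<eta> / \<delta>))) / 2"
  assumes R: "R \<ge> 0" and \<delta>: "0 < \<delta>" "\<delta> < 1" and \<eta>: "0 < \<eta>" "\<eta> \<le> 1" and n: "4 \<le> real n * \<eta>\<^sup>2"
  shows "\<exists>enc c. enc \<in> seq_space n \<rightarrow>\<^sub>M count_space (rate_set R n) \<and>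
    (\<integral>\<^sup>+u. ennreal ((\<Sum>i<n. (c (enc u) i - u i)\<^sup>2) / n) \<partial>gaussian_source 0 1 n)
      \<le> ennreal (\<delta> + 4 * \<eta> + 2 * (1 - p) ^ (card (rate_set R n) - 1) + 4 / (n * \<eta>\<^sup>2))"
proof -
  define P where "P = gaussian_source 0 1 n"
  define N where "N = gaussian_source 0 (sqrt (1 - \<delta>)) n"
  define d where "d = \<delta> + 4 * \<eta>"
  define K where "K = card (rate_set R n)"
  have K: "K > 0" "rate_set R n = {1..K}"
    using rate_set_nonempty[OF R, of n] by (auto simp: K_def card_gt_0_iff) (auto simp: rate_set_def)
  have n0: "n > 0" using n by (cases "n = 0") auto
  interpret P: prob_space P unfolding P_def by (rule prob_space_gaussian_source) simp
  interpret N: prob_space N unfolding N_def by (rule prob_space_gaussian_source) (use \<delta> in simp)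
  have sP [measurable_cong]: "sets P = sets (seq_space n)" and spP: "space P = space (seq_space n)"
    by (simp_all add: P_def)
  have sN [measurable_cong]: "sets N = sets (seq_space n)" and spN: "space N = space (seq_space n)"
    by (simp_all add: N_def)
  define S where "S = {w \<in> space (P \<Otimes>\<^sub>M N). (\<Sum>i<n. (snd w i - fst w i)\<^sup>2) \<le> n * d}"
  define T where "T = {x \<in> space P. (\<Sum>i<n. (x i)\<^sup>2) \<le> n * (1 + \<eta>)}"
  have S: "S \<in> sets (P \<Otimes>\<^sub>M N)" unfolding S_def by measurable
  have T: "T \<in> sets P" unfolding T_def by measurable
  have "0 \<le> n * (ln (1 / \<delta>) / 2 + 2 * \<eta> / \<delta>)"
    using \<delta> \<eta> by (intro mult_nonneg_nonneg add_nonneg_nonneg) auto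
  then have "exp (- (n * (ln (1 / \<delta>) / 2 + 2 * \<eta> / \<delta>))) \<le> 1" by simp
  then have p: "0 \<le> p" "p \<le> 1" unfolding p_def by (simp, linarith)
  have ball: "p \<le> measure N {c \<in> space N. (x, c) \<in> S}" if "x \<in> T" for x
  proof -
    have "{c \<in> space N. (x, c) \<in> S} = {c \<in> space (seq_space n). (\<Sum>i<n. (c i - x i)\<^sup>2) \<le> n * (\<delta> + 4 * \<eta>)}"
      using that by (auto simp: S_def T_def d_def space_pair_measure spN)
    then show ?thesis
      using gauss_ball_ge[OF \<delta> \<eta> n, of x] that by (simp add: p_def N_def T_def)
  qed
  obtain b where b: "\<And>j. b j \<in> space N"
    and unc: "measure P {x \<in> T. \<forall>j<K - 1. (x, b j) \<notin> S} \<le> (1 - p) ^ (K - 1)"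
    using greedy_cover[OF P.prob_space_axioms N.prob_space_axioms S T p ball, of "K - 1"] by auto
  \<comment> \<open>Messages start at 1 and codewords at 0, so the messages 1 to K - 1 carry the
    chosen codewords. Message \<open>K\<close> carries the zero word, whose error is the energy of
    the source.\<close>
  define c where "c m = (if m < K then b (m - 1) else (\<lambda>_. 0))" for m
  define good where "good x m \<longleftrightarrow> (\<Sum>i<n. (c m i - x i)\<^sup>2) \<le> n * d" for x m
  define enc where "enc x = (LEAST m. 1 \<le> m \<and> (m = K \<or> good x m))" for x
  have good_meas [measurable]: "Measurable.pred (seq_space n) (\<lambda>x. good x m)" for m
    unfolding good_def by measurable
  have enc: "1 \<le> enc x \<and> (enc x = K \<or> good x (enc x))" "enc x \<le> K" for x
  proof -
    have "1 \<le> K \<and> (K = K \<or> good x K)" using K by auto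
    then show "1 \<le> enc x \<and> (enc x = K \<or> good x (enc x))" "enc x \<le> K"
      unfolding enc_def by (rule LeastI) (rule Least_le, fact)
  qed
  have "enc \<in> seq_space n \<rightarrow>\<^sub>M count_space UNIV"
    unfolding enc_def by measurable
  then have enc_meas: "enc \<in> seq_space n \<rightarrow>\<^sub>M count_space (rate_set R n)"
    using enc by (intro measurable_count_space_extend[of "rate_set R n" UNIV]) (auto simp: K)
  define B where "B = {x \<in> T. \<forall>j<K - 1. (x, b j) \<notin> S}"
  have "B = T - (\<Union>j<K - 1. (\<lambda>x. (x, b j)) -` S \<inter> space P)"
    using sets.sets_into_space[OF T] by (auto simp: B_def)
  moreover have "(\<lambda>x. (x, b j)) -` S \<inter> space P \<in> sets P" for j
    using b[of j] by (intro measurable_sets[OF _ S]) measurable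
  ultimately have B: "B \<in> sets P"
    using T by (simp only:) (intro sets.Diff sets.finite_UN, auto)
  define F where "F x = (\<Sum>i<n. (x i)\<^sup>2 - 1)" for x :: "nat \<Rightarrow> real"
  \<comment> \<open>For a sequence outside \<open>T\<close>, \<open>y = F x / (n * \<eta>)\<close>
    exceeds 1, so its error 1 + F x / n is at most 1 + y \<le> 2 * y^2 = L * (F x)^2. The mean of (F
    x)^2 is 2 * n, so this part contributes 4 / (n * \<eta>^2).\<close>
  define L where "L = 2 / (n * \<eta>)\<^sup>2"
  have L: "L \<ge> 0" by (simp add: L_def)
  have d0: "d \<ge> 0" using \<delta> \<eta> by (simp add: d_def)
  have pointwise: "(\<Sum>i<n. (c (enc x) i - x i)\<^sup>2) / n \<le> d + 2 * indicator B x + L * (F x)\<^sup>2"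
    if x: "x \<in> space P" for x
  proof (cases "good x (enc x)")
    case True
    then have "(\<Sum>i<n. (c (enc x) i - x i)\<^sup>2) / n \<le> d"
      using n0 by (simp add: good_def field_simps)
    then show ?thesis using L by (simp add: add_increasing2)
  next
    case False
    then have "enc x = K" using enc(1)[of x] by auto
    then have "(\<Sum>i<n. (c (enc x) i - x i)\<^sup>2) = real n + F x"
      by (simp add: c_def F_def sum_subtractf)
    then have eq: "(\<Sum>i<n. (c (enc x) i - x i)\<^sup>2) / n = 1 + F x / n"
      using n0 by (simp add: add_divide_distrib)
    have Feq: "(\<Sum>i<n. (x i)\<^sup>2) = n + F x" by (simp add: F_def sum_subtractf)
    show ?thesis
    proof (cases "x \<in> T")
      case True
      have "x \<in> B"
      proof -
        have "(x, b j) \<notin> S" if "j < K - 1" for j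
        proof
          assume "(x, b j) \<in> S"
          then have "good x (Suc j)" using that by (simp add: S_def good_def c_def)
          then have "enc x \<le> Suc j" unfolding enc_def by (intro Least_le) simp
          then show False using \<open>enc x = K\<close> that by simp
        qed
        then show ?thesis using True by (simp add: B_def)
      qed
      have "F x \<le> n * \<eta>" using True Feq by (simp add: T_def algebra_simps)
      then have "F x / n \<le> \<eta>" using n0 by (simp add: field_simps)
      \<comment> \<open>This is the factor 2 in front of the indicator of \<open>B\<close>: inside
        \<open>T\<close> the fallback word costs at most 1 + \<eta>.\<close>
      then have "1 + F x / n \<le> 2" using \<eta> by simp
      then show ?thesis using \<open>x \<in> B\<close> d0 L eq by (simp add: add_increasing2 add_increasing)
    next
      case False
      then have F: "n * \<eta> < F x" using x Feq by (simp add: T_def algebra_simps)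
      define y where "y = F x / (n * \<eta>)"
      have y: "1 < y" "F x / n = y * \<eta>" using F n0 \<eta> by (auto simp: y_def field_simps)
      have "1 + F x / n \<le> 1 + y" using y \<eta> by simp
      also have "\<dots> \<le> 2 * y\<^sup>2"
        using y(1) mult_strict_right_mono[of 1 y y] unfolding power2_eq_square by linarith
      also have "\<dots> = L * (F x)\<^sup>2" by (simp add: L_def y_def power_divide)
      finally show ?thesis using d0 eq by (simp add: add_increasing)
    qed
  qed
  have hb: "has_bochner_integral P (\<lambda>x. (F x)\<^sup>2) (n * 2)"
  proof -
    note g = gauss_variance_of_square[of 1 0, simplified]
    have "has_bochner_integral P (\<lambda>x. (F x)\<^sup>2) (\<Sum>i<n. \<integral>x. (x\<^sup>2 - 1)\<^sup>2 \<partial>gauss 0 1)"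
      unfolding P_def gaussian_source_def F_def
      by (rule has_bochner_integral_square_sum_PiM)
        (use g prob_space_normal_density[of 1 0] in \<open>auto simp: has_bochner_integral_iff\<close>)
    then show ?thesis using g by (simp add: has_bochner_integral_iff)
  qed
  have [measurable]: "F \<in> borel_measurable P" unfolding F_def by measurable
  note B [measurable]
  have "(\<integral>\<^sup>+u. ennreal ((\<Sum>i<n. (c (enc u) i - u i)\<^sup>2) / n) \<partial>P)
    \<le> (\<integral>\<^sup>+u. ennreal d + ennreal 2 * indicator B u + ennreal L * ennreal ((F u)\<^sup>2) \<partial>P)"
  proof (rule nn_integral_mono)
    fix u assume u: "u \<in> space P"
    have "ennreal ((\<Sum>i<n. (c (enc u) i - u i)\<^sup>2) / n) \<le> ennreal (d + 2 * indicator B u + L * (F u)\<^sup>2)"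
      by (rule ennreal_leI[OF pointwise[OF u]])
    also have "\<dots> = ennreal d + ennreal 2 * indicator B u + ennreal L * ennreal ((F u)\<^sup>2)"
      using d0 L by (simp add: ennreal_mult[symmetric] indicator_def)
    finally show "ennreal ((\<Sum>i<n. (c (enc u) i - u i)\<^sup>2) / n)
      \<le> ennreal d + ennreal 2 * indicator B u + ennreal L * ennreal ((F u)\<^sup>2)" .
  qed
  also have "\<dots> = ennreal d + ennreal 2 * emeasure P B + ennreal L * (\<integral>\<^sup>+u. ennreal ((F u)\<^sup>2) \<partial>P)"
    by (simp add: nn_integral_add nn_integral_cmult nn_integral_cmult_indicator P.emeasure_space_1)
  also have "(\<integral>\<^sup>+u. ennreal ((F u)\<^sup>2) \<partial>P) = ennreal (n * 2)"
    using hb by (subst nn_integral_eq_integral) (auto simp: has_bochner_integral_iff)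
  also have "ennreal d + ennreal 2 * emeasure P B + ennreal L * ennreal (n * 2)
      = ennreal (d + 2 * measure P B + L * (n * 2))"
    using d0 L by (simp add: P.emeasure_eq_measure ennreal_mult)
  also have "\<dots> \<le> ennreal (d + 2 * (1 - p) ^ (K - 1) + 4 / (n * \<eta>\<^sup>2))"
  proof (intro ennreal_leI add_mono mult_left_mono)
    show "measure P B \<le> (1 - p) ^ (K - 1)" using unc by (simp add: B_def)
    show "L * (n * 2) \<le> 4 / (n * \<eta>\<^sup>2)"
      using n0 \<eta> by (simp add: L_def power2_eq_square field_simps)
  qed auto
  finally show ?thesis
    using enc_meas by (auto simp: d_def K_def P_def)
qed

lemma one_minus_power_le_exp:
  fixes p :: real
  assumes "0 \<le> p" "p \<le> 1"
  shows "(1 - p) ^ k \<le> exp (- (p * k))"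
proof -
  have "(1 - p) ^ k \<le> exp (- p) ^ k"
    using assms exp_ge_add_one_self[of "- p"] by (intro power_mono) auto
  then show ?thesis by (simp add: exp_of_nat_mult[symmetric] mult.commute)
qed

text \<open>With \<delta> slightly above 2 powr (- 2 * R) the codebook grows exponentially faster
  than the covering probability of one codeword decays, so the uncovered part vanishes doubly
  exponentially.\<close>

lemma eventually_rate_distortion_code:
  assumes R: "R > 0" and \<epsilon>: "\<epsilon> > 0"
  shows "\<forall>\<^sub>F n in sequentially. \<exists>enc c. enc \<in> seq_space n \<rightarrow>\<^sub>M count_space (rate_set R n) \<and>
    (\<integral>\<^sup>+u. ennreal ((\<Sum>i<n. (c (enc u) i - u i)\<^sup>2) / n) \<partial>gaussian_source 0 1 n)
      \<le> ennreal (2 powr (- 2 * R) + \<epsilon>)"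
proof -
  define \<delta>0 where "\<delta>0 = 2 powr (- 2 * R)"
  have \<delta>0: "0 < \<delta>0" "\<delta>0 < 1"
    using R by (auto simp: \<delta>0_def powr_less_one)
  \<comment> \<open>Strictly between \<open>\<delta>0\<close> and 1 and within \<epsilon> / 4 of
    \<open>\<delta>0\<close>; the midpoint keeps it below 1.\<close>
  define \<delta> where "\<delta> = min ((1 + \<delta>0) / 2) (\<delta>0 + \<epsilon> / 4)"
  have \<delta>: "\<delta>0 < \<delta>" "0 < \<delta>" "\<delta> < 1" "\<delta> \<le> \<delta>0 + \<epsilon> / 4"
    using \<delta>0 \<epsilon> by (auto simp: \<delta>_def min_def)
  \<comment> \<open>The surplus of the rate over the covering exponent, in nats. It would be zero at
    \<open>\<delta>0\<close>.\<close>
  define gap where "gap = R * ln 2 - ln (1 / \<delta>) / 2"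
  have "ln \<delta>0 < ln \<delta>" using \<delta> \<delta>0 by simp
  then have gap: "gap > 0"
    using \<delta> by (simp add: gap_def \<delta>0_def ln_powr ln_div)
  \<comment> \<open>The second bound keeps 4 * \<eta> within \<epsilon> / 4. The third spends at
    most half of the gap on the slack in the covering exponent. The terms that vanish with n get the
    remaining \<epsilon> / 2.\<close>
  define \<eta> where "\<eta> = min 1 (min (\<epsilon> / 16) (gap * \<delta> / 4))"
  have \<eta>: "0 < \<eta>" "\<eta> \<le> 1" "4 * \<eta> \<le> \<epsilon> / 4" "2 * \<eta> / \<delta> \<le> gap / 2"
    using \<epsilon> gap \<delta> by (auto simp: \<eta>_def min_def field_simps)
  define a where "a = ln (1 / \<delta>) / 2 + 2 * \<eta> / \<delta>"
  have "a \<ge> 0"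
    using \<delta> \<eta>(1) by (simp add: a_def)
  moreover have "a + gap / 2 \<le> R * ln 2"
    using \<eta>(4) gap_def unfolding a_def by linarith
  ultimately have a: "a \<ge> 0" "a + gap / 2 \<le> R * ln 2" .
  define p where "p n = exp (- (real n * a)) / 2" for n
  have p: "0 \<le> p n" "p n \<le> 1" for n
  proof -
    have "exp (- (real n * a)) \<le> 1" using a by simp
    then show "0 \<le> p n" "p n \<le> 1" unfolding p_def by (simp, linarith)
  qed
  \<comment> \<open>Rounding and the fallback message cost at most 2 codewords; since 2 * p n \<le>
    1, this is the summand 1 in the exponent.\<close>
  have power_le: "(1 - p n) ^ (card (rate_set R n) - 1) \<le> exp (1 - exp (n * (gap / 2)) / 2)" for n
  proof -
    define K where "K = card (rate_set R n)"
    have "2 powr (real n * R) = exp (n * (R * ln 2))" by (simp add: powr_def mult_ac)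
    moreover have "2 powr (real n * R) - 2 \<le> real (K - 1)"
      using card_rate_set_gt[of n R] unfolding K_def by linarith
    ultimately have "exp (n * (R * ln 2)) - 2 \<le> real (K - 1)" by simp
    then have "p n * (exp (n * (R * ln 2)) - 2) \<le> p n * real (K - 1)"
      using p by (intro mult_left_mono)
    moreover have "exp (n * (gap / 2)) / 2 - 1 \<le> p n * (exp (n * (R * ln 2)) - 2)"
    proof -
      have "exp (n * (gap / 2)) \<le> exp (- (real n * a)) * exp (n * (R * ln 2))"
        using mult_left_mono[OF a(2), of "real n"] by (simp add: mult_exp_exp algebra_simps)
      moreover have "exp (- (real n * a)) \<le> 1" using a by simp
      ultimately show ?thesis unfolding p_def right_diff_distrib by linarith
    qed
    ultimately have "exp (- (p n * real (K - 1))) \<le> exp (1 - exp (n * (gap / 2)) / 2)" by simp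
    then show ?thesis
      using one_minus_power_le_exp[OF p, of n "K - 1"] unfolding K_def by linarith
  qed
  have g2: "gap / 2 > 0" using gap by simp
  have "(\<lambda>n. 2 * exp (1 - exp (real n * (gap / 2)) / 2) + 4 / (real n * \<eta>\<^sup>2)) \<longlonglongrightarrow> 0"
    using g2 \<eta>(1) by real_asymp
  then have "\<forall>\<^sub>F n in sequentially. 2 * exp (1 - exp (real n * (gap / 2)) / 2) + 4 / (real n * \<eta>\<^sup>2) < \<epsilon> / 2"
    using \<epsilon> by (intro order_tendstoD) auto
  moreover have "\<forall>\<^sub>F n in sequentially. 4 \<le> real n * \<eta>\<^sup>2"
    using \<eta>(1) by real_asymp
  ultimately show ?thesis
  proof eventually_elim
    case (elim n)
    obtain enc c where enc: "enc \<in> seq_space n \<rightarrow>\<^sub>M count_space (rate_set R n)"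
      and le: "(\<integral>\<^sup>+u. ennreal ((\<Sum>i<n. (c (enc u) i - u i)\<^sup>2) / n) \<partial>gaussian_source 0 1 n)
      \<le> ennreal (\<delta> + 4 * \<eta> + 2 * (1 - p n) ^ (card (rate_set R n) - 1) + 4 / (n * \<eta>\<^sup>2))"
      using rate_distortion_code[OF less_imp_le[OF R] \<delta>(2,3) \<eta>(1,2) elim(2)]
      unfolding p_def a_def by blast
    have "\<delta> + 4 * \<eta> + 2 * (1 - p n) ^ (card (rate_set R n) - 1) + 4 / (n * \<eta>\<^sup>2) \<le> \<delta>0 + \<epsilon>"
      using elim(1) power_le[of n] \<delta>(4) \<eta>(3) by linarith
    then have "ennreal (\<delta> + 4 * \<eta> + 2 * (1 - p n) ^ (card (rate_set R n) - 1) + 4 / (n * \<eta>\<^sup>2))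
        \<le> ennreal (2 powr (- 2 * R) + \<epsilon>)"
      unfolding \<delta>0_def[symmetric] by (rule ennreal_leI)
    with enc le show ?case by (meson order.trans)
  qed
qed

text \<open>At rate 0 the target distortion is 1, and the single message with the zero word attains
  the variance of the source. The covering construction needs \<delta> < 1 and a positive gap, which
  are incompatible here.\<close>

lemma rate_zero_code:
  assumes "n > 0"
  shows "\<exists>enc c. enc \<in> seq_space n \<rightarrow>\<^sub>M count_space (rate_set 0 n) \<and>
    (\<integral>\<^sup>+u. ennreal ((\<Sum>i<n. (c (enc u) i - u i)\<^sup>2) / n) \<partial>gaussian_source 0 1 n) \<le> ennreal 1"
proof (intro exI conjI)
  show "(\<lambda>_. 1 :: nat) \<in> seq_space n \<rightarrow>\<^sub>M count_space (rate_set 0 n)"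
    by (simp add: rate_set_def)
  have "(\<integral>\<^sup>+u. ennreal ((\<Sum>i<n. ((\<lambda>_ _. 0) (1 :: nat) i - u i)\<^sup>2) / n) \<partial>gaussian_source 0 1 n)
    = (\<integral>\<^sup>+u. (\<Sum>i<n. ennreal ((u i - 0)\<^sup>2)) / ennreal n \<partial>gaussian_source 0 1 n)"
    using assms by (intro nn_integral_cong) (simp add: divide_ennreal sum_nonneg)
  also have "\<dots> = (\<Sum>i<n. \<integral>\<^sup>+u. ennreal ((u i - 0)\<^sup>2) \<partial>gaussian_source 0 1 n) / ennreal n"
    by (simp add: nn_integral_divide nn_integral_sum del: sum_ennreal)
  also have "\<dots> = ennreal 1"
    using assms nn_integral_gaussian_source_square[of 1 _ n 0]
    by (simp add: ennreal_of_nat_eq_real_of_nat divide_ennreal)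
  finally show "(\<integral>\<^sup>+u. ennreal ((\<Sum>i<n. ((\<lambda>_ _. 0) (1 :: nat) i - u i)\<^sup>2) / n) \<partial>gaussian_source 0 1 n) \<le> ennreal 1"
    by simp
qed

section \<open>From keys to sign patterns, and the share of wasted keys\<close>

text \<open>The keys in \<open>G\<close> cover every sign pattern equally often; the others do not suffice
  for another round and are wasted on the pattern \<open>0\<close>.\<close>

lemma key_signs:
  fixes N n :: nat
  obtains G :: "nat set" and \<kappa> :: "nat \<Rightarrow> nat \<Rightarrow> real" and \<tau> :: "nat \<Rightarrow> nat \<Rightarrow> nat"
  where "G \<subseteq> {1..N}" "card ({1..N} - G) = N mod 2 ^ n"
    "\<And>k i. k \<in> G \<Longrightarrow> \<bar>\<kappa> k i\<bar> = 1" "\<And>k i. k \<in> {1..N} - G \<Longrightarrow> \<kappa> k i = 0"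
    "\<And>i. i < n \<Longrightarrow> bij_betw (\<tau> i) {1..N} {1..N}"
    "\<And>i j k. i < n \<Longrightarrow> k \<in> {1..N} \<Longrightarrow> \<kappa> (\<tau> i k) j = (if j = i then - \<kappa> k j else \<kappa> k j)"
proof -
  \<comment> \<open>The largest multiple of 2^n up to \<open>N\<close>. Key \<open>k\<close> in
    \<open>{1..q}\<close> takes its signs from the low n bits of \<open>k - 1\<close>, the shift
    being due to keys starting at 1.\<close>
  define q where "q = N div 2 ^ n * 2 ^ n"
  define \<kappa> where "\<kappa> k i = (if k \<in> {1..q} then if bit (k - 1) i then - 1 else 1 else 0 :: real)" for k i
  define \<tau> where "\<tau> i k = (if k \<in> {1..q} then Suc (flip_bit i (k - 1)) else k)" for i k
  have q: "q \<le> N" by (simp add: q_def)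
  have "N - q = N mod 2 ^ n"
    unfolding q_def by (metis minus_div_mult_eq_mod)
  moreover have "{1..N} - {1..q} = {Suc q..N}" by auto
  ultimately have card: "card ({1..N} - {1..q}) = N mod 2 ^ n" by simp
  \<comment> \<open>Flipping one of the low n bits keeps the quotient by 2^n, and below a multiple
    of 2^n only the quotient decides. So the flip never leaves the good keys.\<close>
  have flip_less: "flip_bit i a < q" if "i < n" "a < q" for i a :: nat
  proof -
    have "drop_bit n (flip_bit i a) = drop_bit n a"
      using that by (intro bit_eqI) (auto simp: bit_drop_bit_eq bit_flip_bit_iff)
    then have "flip_bit i a div 2 ^ n = a div 2 ^ n" by (simp add: drop_bit_eq_div)
    then show ?thesis using that(2) by (simp add: q_def div_less_iff_less_mult[symmetric])
  qed
  have invol: "flip_bit i (flip_bit i a) = a" for i a :: nat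
    by (intro bit_eqI) (auto simp: bit_flip_bit_iff)
  have in_G: "\<tau> i k \<in> {1..q}" if "i < n" "k \<in> {1..q}" for i k
  proof -
    have "k - 1 < q" using that by auto
    from flip_less[OF that(1) this] show ?thesis using that by (simp add: \<tau>_def Suc_le_eq)
  qed
  have \<tau>2: "\<tau> i (\<tau> i k) = k" if "i < n" for i k
  proof (cases "k \<in> {1..q}")
    case True
    then show ?thesis using in_G[OF that True] by (auto simp: \<tau>_def invol)
  qed (auto simp: \<tau>_def)
  show ?thesis
  proof
    show "{1..q} \<subseteq> {1..N}" using q by auto
    show "card ({1..N} - {1..q}) = N mod 2 ^ n" by (rule card)
    show "\<bar>\<kappa> k i\<bar> = 1" if "k \<in> {1..q}" for k i using that by (simp add: \<kappa>_def)
    show "\<kappa> k i = 0" if "k \<in> {1..N} - {1..q}" for k i using that by (auto simp: \<kappa>_def)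
    show "bij_betw (\<tau> i) {1..N} {1..N}" if i: "i < n" for i
    proof (rule bij_betw_byWitness[where f'="\<tau> i"])
      have "\<tau> i k \<in> {1..N}" if "k \<in> {1..N}" for k
        using in_G[OF i, of k] that q by (cases "k \<in> {1..q}") (auto simp: \<tau>_def)
      then show "\<tau> i ` {1..N} \<subseteq> {1..N}" "\<tau> i ` {1..N} \<subseteq> {1..N}" by auto
    qed (use \<tau>2[OF i] in auto)
    show "\<kappa> (\<tau> i k) j = (if j = i then - \<kappa> k j else \<kappa> k j)" if i: "i < n" and "k \<in> {1..N}" for i j k
    proof (cases "k \<in> {1..q}")
      case True
      then show ?thesis
        using in_G[OF i True] by (auto simp: \<kappa>_def \<tau>_def bit_flip_bit_iff)
    next
      case False
      then show ?thesis by (auto simp: \<kappa>_def \<tau>_def)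
    qed
  qed
qed

text \<open>The remainder stays below 2^n, while for \<open>Rs > 1\<close> the number of keys is
  exponentially larger. At \<open>Rs = 1\<close> there are exactly 2^n keys and the remainder is 0;
  this boundary case needs its own argument because the quotient of the two bounds no longer
  vanishes.\<close>

lemma wasted_keys_tendsto_0:
  assumes "Rs \<ge> 1"
  shows "(\<lambda>n. real (card (rate_set Rs n) mod 2 ^ n) / card (rate_set Rs n)) \<longlonglongrightarrow> 0"
proof (cases "Rs = 1")
  case True
  have "card (rate_set 1 n) = 2 ^ n" for n
    by (simp add: rate_set_def powr_realpow)
  then show ?thesis using True by simp
next
  case False
  define h where "h = (Rs - 1) * ln 2"
  have h: "h > 0" using False assms by (simp add: h_def)
  have bound: "\<forall>\<^sub>F n in sequentially. norm (real (card (rate_set Rs n) mod 2 ^ n) / card (rate_set Rs n))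
      \<le> 1 / (exp (n * h) - 1)"
    using eventually_gt_at_top[of 0]
  proof eventually_elim
    case (elim n)
    have "2 powr (real n * Rs) = 2 ^ n * exp (n * h)"
    proof -
      have "real n * Rs * ln 2 = real n * ln 2 + n * h" by (simp add: h_def algebra_simps)
      moreover have "exp (real n * ln 2) = 2 ^ n" by (simp add: exp_of_nat_mult)
      ultimately show ?thesis by (simp add: powr_def exp_add)
    qed
    moreover have "2 powr (real n * Rs) - 1 < card (rate_set Rs n)"
      by (rule card_rate_set_gt)
    ultimately have less: "2 ^ n * exp (n * h) - 1 < real (card (rate_set Rs n))" by simp
    have pos: "0 < exp (n * h) - 1" using h elim by simp
    have "2 ^ n * (exp (n * h) - 1) \<le> 2 ^ n * exp (n * h) - (1 :: real)"
      by (simp add: algebra_simps)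
    with less have less': "2 ^ n * (exp (n * h) - 1) \<le> real (card (rate_set Rs n))" by linarith
    have "card (rate_set Rs n) mod 2 ^ n \<le> 2 ^ n"
      by (simp add: less_imp_le)
    then have "real (card (rate_set Rs n) mod 2 ^ n) \<le> 2 ^ n"
      by (metis of_nat_le_iff of_nat_numeral of_nat_power)
    then have "real (card (rate_set Rs n) mod 2 ^ n) / card (rate_set Rs n) \<le> 2 ^ n / (2 ^ n * (exp (n * h) - 1))"
      using less' pos by (intro frac_le) auto
    then show ?case by simp
  qed
  have "(\<lambda>n. 1 / (exp (real n * h) - 1) :: real) \<longlonglongrightarrow> 0"
    using h by real_asymp
  with bound show ?thesis by (rule Lim_null_comparison)
qed

section \<open>The limit of the game values and the optimal payoff\<close>

lemma game_value_tendsto: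
  assumes \<sigma>: "\<sigma> > 0" and R: "R \<ge> 0" and Rs: "Rs \<ge> 1"
  shows "game_value \<mu> \<sigma> R Rs \<longlonglongrightarrow> ereal (1 - 2 powr (- 2 * R))"
proof (rule order_tendstoI)
  fix u assume u: "ereal (1 - 2 powr (- 2 * R)) < u"
  show "\<forall>\<^sub>F n in sequentially. game_value \<mu> \<sigma> R Rs n < u"
    using eventually_gt_at_top[of 0]
  proof eventually_elim
    case (elim n)
    show ?case using game_value_le[OF \<sigma> R _ elim, of Rs] Rs u by (auto intro: le_less_trans)
  qed
next
  fix l assume l: "l < ereal (1 - 2 powr (- 2 * R))"
  \<comment> \<open>The bound \<open>l\<close> is an extended real and may be minus infinity; a real
    number is put in between to measure the slack.\<close>
  obtain r where r: "l < ereal r" "r < 1 - 2 powr (- 2 * R)"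
    using ereal_dense2[OF l] by auto
  \<comment> \<open>One half of the slack pays for the distortion of the code, the other half for
    the wasted keys.\<close>
  define \<epsilon> where "\<epsilon> = (1 - 2 powr (- 2 * R) - r) / 2"
  have \<epsilon>: "\<epsilon> > 0" using r by (simp add: \<epsilon>_def)
  have Rs0: "Rs \<ge> 0" using Rs by simp
  have code: "\<forall>\<^sub>F n in sequentially. \<exists>enc c. enc \<in> seq_space n \<rightarrow>\<^sub>M count_space (rate_set R n) \<and>
    (\<integral>\<^sup>+u. ennreal ((\<Sum>i<n. (c (enc u) i - u i)\<^sup>2) / n) \<partial>gaussian_source 0 1 n)
      \<le> ennreal (2 powr (- 2 * R) + \<epsilon>)"
  proof (cases "R = 0")
    case True
    show ?thesis
      using eventually_gt_at_top[of 0]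
    proof eventually_elim
      case (elim n)
      have "ennreal 1 \<le> ennreal (2 powr (- 2 * R) + \<epsilon>)"
        using True \<epsilon> by (intro ennreal_leI) simp
      then show ?case using rate_zero_code[OF elim] True by (meson order.trans)
    qed
  next
    case False
    then show ?thesis using R by (intro eventually_rate_distortion_code \<epsilon>) simp
  qed
  have "\<forall>\<^sub>F n in sequentially. real (card (rate_set Rs n) mod 2 ^ n) / card (rate_set Rs n) < \<epsilon>"
    using wasted_keys_tendsto_0[OF Rs] \<epsilon> by (rule order_tendstoD)
  with code eventually_gt_at_top[of 0] show "\<forall>\<^sub>F n in sequentially. l < game_value \<mu> \<sigma> R Rs n"
  proof eventually_elim
    case (elim n)
    obtain enc c where enc: "enc \<in> seq_space n \<rightarrow>\<^sub>M count_space (rate_set R n)"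
      and D: "(\<integral>\<^sup>+u. ennreal ((\<Sum>i<n. (c (enc u) i - u i)\<^sup>2) / n) \<partial>gaussian_source 0 1 n)
      \<le> ennreal (2 powr (- 2 * R) + \<epsilon>)"
      using elim(1) by blast
    define N where "N = card (rate_set Rs n)"
    have A: "rate_set Rs n = {1..N}" by (simp add: N_def rate_set_def)
    obtain G \<kappa> \<tau> where k: "G \<subseteq> {1..N}" "card ({1..N} - G) = N mod 2 ^ n"
      "\<And>k i. k \<in> G \<Longrightarrow> \<bar>\<kappa> k i :: real\<bar> = 1" "\<And>k i. k \<in> {1..N} - G \<Longrightarrow> \<kappa> k i = 0"
      "\<And>i. i < n \<Longrightarrow> bij_betw (\<tau> i) {1..N} {1..N}"
      "\<And>i j k. i < n \<Longrightarrow> k \<in> {1..N} \<Longrightarrow> \<kappa> (\<tau> i k) j = (if j = i then - \<kappa> k j else \<kappa> k j)"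
      by (rule key_signs[of N n]) blast
    have "ereal (1 - (2 powr (- 2 * R) + \<epsilon> + card (rate_set Rs n - G) / card (rate_set Rs n)))
        \<le> game_value \<mu> \<sigma> R Rs n"
      by (rule game_value_ge[OF \<sigma> Rs0 elim(2) enc, of G \<kappa> \<tau> c])
        (use k D \<epsilon> in \<open>auto simp: A\<close>)
    moreover have "r \<le> 1 - (2 powr (- 2 * R) + \<epsilon> + card (rate_set Rs n - G) / card (rate_set Rs n))"
      using elim(3) k(2) by (simp add: A \<epsilon>_def field_simps)
    ultimately show ?case
      using r(1) by (meson ereal_less_eq(3) less_le_trans order.trans)
  qed
qed

theorem theorem3:
  fixes \<mu>\<^sub>0 \<sigma>\<^sub>0 R Rs :: real
  assumes "\<sigma>\<^sub>0 > 0"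
    and "R \<ge> 0"
    and "Rs \<ge> 1"
  shows "secrecy_rate_payoff \<mu>\<^sub>0 \<sigma>\<^sub>0 R Rs = 1 - 2 powr (- 2 * R)"
proof -
  \<comment> \<open>The game values converge, so the limit \<open>L\<close> is unique and
    achievability means lying below it. The achievable values form a closed half-line, whose
    endpoint is the maximum that \<open>GREATEST\<close> asks for.\<close>
  have "achievable \<mu>\<^sub>0 \<sigma>\<^sub>0 R Rs P \<longleftrightarrow> P \<le> 1 - 2 powr (- 2 * R)" for P
    using game_value_tendsto[OF assms, of \<mu>\<^sub>0]
    by (auto simp: achievable_def dest: LIMSEQ_unique)
  then show ?thesis
    unfolding secrecy_rate_payoff_def by (intro Greatest_equality) auto
qed

end
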